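(* For all real $x>0$ and $a>0$, $$\frac{\pi}{2}\sum_{n\ge1}\frac{\mu(n)}{n}e^{-ax/n}\;=\;a\int_{0}^{\infty}\sum_{n\ge1}\frac{\mu(n)}{n^2}e^{-a^2y/n^2}\left(\frac{\sqrt{\pi}}{2}\,y^{-1/2}e^{-x^2/(4y)}\right)dy .$$
   Context: $\mu(n)$ denotes the Möbius function. *)

theory Defs
  imports "HOL-Analysis.Analysis" "HOL-Computational_Algebra.Squarefree"
begin

text \<open>The Moebius function; its value at 0 is 0, since 0 is not squarefree.\<close>

definition moebius_mu :: "nat \<Rightarrow> real" where
  "moebius_mu n = (if squarefree n then (- 1) ^ card (prime_factors n) else 0)"

end

theory Submission
  imports Defs "HOL-Complex_Analysis.Complex_Analysis" "HOL-Probability.Probability" "HOL-Real_Asymp.Real_Asymp"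
begin

text \<open>
  Termwise, the identity is the classical evaluation of the integral of
  $y^{-1/2} \exp(-p^2 y - q^2/y)$, for which an antiderivative in terms of the error function is
  available. The series on the left converges only conditionally: its convergence is equivalent to
  that of $\sum \mu(n)/n$ and hence to the prime number theorem.

  The latter is obtained from Ingham's Fourier-analytic argument. With $m(t)$ the sum of $\mu(n)/n$
  over $n < e^t$, the Laplace transform of $m$ is $1 / (s \zeta(1+s))$, which is continuous on
  $\Re s \ge 0$ because zeta has no zero on the line $\Re s = 1$. Convolving $m$ with a Fejer kernel
  makes the transform compactly supported, so the Riemann-Lebesgue lemma sends the convolution to 0;
  as $m$ is slowly oscillating, narrow kernels recover $m \to 0$ itself.

  Sum and integral are interchanged on $(0, Y]$, where convergence is absolute. The error from the
  tails over $(Y, \infty)$ vanishes as $Y \to \infty$ by Abel summation, since the tail belonging to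
  $n$, divided by $n$, is increasing in $n$ and uniformly bounded.
\<close>

section \<open>Moebius sums\<close>

text \<open>Accordingly the integral is a gauge integral, obtained as the limit of integrals over
  (0, Y].

  Three facts carry the Tauberian part. The elementary bound |m| <= 1 makes the Laplace transform
  exist for Re s > 0 and supplies the majorants. The simple pole of zeta at 1 cancels the factor s
  in s zeta(1 + s), so the transform is written with (s - 1) zeta(s) and is finite at s = 0 as well.
  Zeros on the line Re s = 1 are excluded by Mertens's inequality 3 + 4 cos t + cos 2t >= 0: a zero
  at 1 + i t, counted four times, would outweigh the pole at 1, counted three times.

  The Fejer kernel enters because its Fourier transform is a triangle function: only values of the
  Laplace transform near a bounded segment of the imaginary axis matter, where continuity alone
  gives boundedness.\<close>

lemma squarefree_prod_primes:
  fixes P :: "nat set"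
  assumes "finite P" "\<And>p. p \<in> P \<Longrightarrow> prime p"
  shows "squarefree (\<Prod>P)"
proof (rule squarefree_prod_coprime)
  show "squarefree p" if "p \<in> P" for p
    using assms(2) that by (simp add: squarefree_prime)
  show "coprime p q" if "p \<in> P" "q \<in> P" "p \<noteq> q" for p q
    using assms(2) that by (simp add: primes_coprime)
qed

lemma prime_factors_prod_primes:
  fixes P :: "nat set"
  assumes "finite P" "\<And>p. p \<in> P \<Longrightarrow> prime p"
  shows "prime_factors (\<Prod>P) = P"
  using assms
proof (induction P rule: finite_induct)
  case (insert p P)
  have "prime p" using insert by simp
  moreover have "0 \<notin> P" using insert.prems not_prime_0 by (metis insert_iff)
  then have "\<Prod>P \<noteq> 0" using insert by (simp add: prod_zero_iff)
  ultimately show ?case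
    using insert prime_factors_product[of p "\<Prod>P"]
    by (simp add: prime_prime_factors prime_gt_0_nat)
qed simp

lemma squarefree_eq_prod_prime_factors:
  fixes n :: nat
  assumes "squarefree n"
  shows "\<Prod>(prime_factors n) = n"
proof -
  have "n \<noteq> 0" using assms by (metis not_squarefree_0)
  then have "n = (\<Prod>p\<in>prime_factors n. p ^ multiplicity p n)"
    by (simp add: prime_factorization_nat)
  also have "\<dots> = \<Prod>(prime_factors n)"
  proof (intro prod.cong refl)
    fix p assume "p \<in> prime_factors n"
    then have "multiplicity p n = 1"
      using assms \<open>n \<noteq> 0\<close> unfolding squarefree_factorial_semiring''[OF \<open>n \<noteq> 0\<close>]
      by (auto simp: prime_factors_multiplicity le_Suc_eq)
    then show "p ^ multiplicity p n = p" by simp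
  qed
  finally show ?thesis ..
qed

lemma moebius_mu_prod_primes:
  assumes "finite P" "\<And>p. p \<in> P \<Longrightarrow> prime p"
  shows "moebius_mu (\<Prod>P) = (- 1) ^ card P"
  using assms by (simp add: moebius_mu_def squarefree_prod_primes prime_factors_prod_primes)

lemma abs_moebius_mu_le: "\<bar>moebius_mu n\<bar> \<le> 1"
  by (simp add: moebius_mu_def)

text \<open>The inverse is \<open>prime_factors\<close>. This lets alternating sums over sets of
  primes be reindexed as Moebius sums over squarefree numbers, both for divisor sums and for the
  expansion of Euler products.\<close>

lemma inj_on_prod_primes:
  assumes "finite P" "\<And>p::nat. p \<in> P \<Longrightarrow> prime p"
  shows "inj_on \<Prod> (Pow P)"
proof (rule inj_on_inverseI)
  show "prime_factors (\<Prod>T) = T" if "T \<in> Pow P" for T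
    using that assms by (intro prime_factors_prod_primes) (auto dest: finite_subset)
qed

text \<open>Only squarefree divisors contribute, and they are the products of subsets of the prime
  factors. The resulting alternating sum expands a product of factors 1 - 1, which is nonzero only
  when it is empty.\<close>

lemma sum_moebius_mu_divisors:
  assumes "n > 0"
  shows "(\<Sum>d | d dvd n. moebius_mu d) = (if n = 1 then 1 else 0)"
proof -
  let ?P = "prime_factors n"
  have sub: "finite T" "\<And>p. p \<in> T \<Longrightarrow> prime p" if "T \<in> Pow ?P" for T
    using that by (auto dest: finite_subset)
  have eq: "\<Prod> ` Pow ?P = {d. d dvd n \<and> squarefree d}"
  proof (intro equalityI subsetI)
    fix d assume "d \<in> \<Prod> ` Pow ?P"
    then obtain T where T: "T \<in> Pow ?P" "d = \<Prod>T" by auto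
    have "d dvd n"
    proof -
      have "\<Prod>T dvd \<Prod>?P" using T by (intro prod_dvd_prod_subset) auto
      also have "\<dots> dvd (\<Prod>p\<in>?P. p ^ multiplicity p n)"
        using assms by (intro prod_dvd_prod) (auto simp: prime_factors_multiplicity)
      also have "\<dots> = n" using assms by (simp add: prime_factorization_nat[symmetric])
      finally show ?thesis using T by simp
    qed
    then show "d \<in> {d. d dvd n \<and> squarefree d}"
      using squarefree_prod_primes[OF sub[OF T(1)]] T by simp
  next
    fix d assume d: "d \<in> {d. d dvd n \<and> squarefree d}"
    then have "prime_factors d \<subseteq> ?P" using assms dvd_prime_factors[of n d] by simp
    then show "d \<in> \<Prod> ` Pow ?P" using squarefree_eq_prod_prime_factors[of d] d
      by (intro image_eqI[of _ _ "prime_factors d"]) auto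
  qed
  have "(\<Sum>d | d dvd n. moebius_mu d) = (\<Sum>d | d dvd n \<and> squarefree d. moebius_mu d)"
    using assms by (intro sum.mono_neutral_right) (auto simp: moebius_mu_def)
  also have "\<dots> = (\<Sum>T\<in>Pow ?P. moebius_mu (\<Prod>T))"
    by (subst eq[symmetric], subst sum.reindex) (auto intro!: inj_on_prod_primes)
  also have "\<dots> = (\<Sum>T\<in>Pow ?P. (- 1) ^ card T)"
    by (intro sum.cong moebius_mu_prod_primes sub) auto
  also have "\<dots> = (\<Prod>p\<in>?P. (1::real) - 1)"
    using prod_diff_conv_sum[of ?P "\<lambda>_. 1::real" "\<lambda>_. 1"] by simp
  also have "\<dots> = (if n = 1 then 1 else 0)"
    using assms by (auto simp: prime_factorization_empty_iff card_gt_0_iff)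
  finally show ?thesis .
qed

text \<open>Double counting: \<open>N div n\<close> is the number of multiples of n up to N, and
  exchanging the sums leaves a divisor sum for each k, of which only k = 1 survives.\<close>

lemma sum_moebius_mu_div: "N > 0 \<Longrightarrow> (\<Sum>n=1..N. moebius_mu n * real (N div n)) = 1"
proof -
  assume N: "N > 0"
  have card: "card {k\<in>{1..N}. n dvd k} = N div n" if "n \<in> {1..N}" for n
  proof -
    have "{k\<in>{1..N}. n dvd k} = (\<lambda>j. n * j) ` {1..N div n}"
      using that by (auto simp: image_iff less_eq_div_iff_mult_less_eq mult.commute elim!: dvdE)
    moreover have "inj_on (\<lambda>j. n * j) {1..N div n}" using that by (auto simp: inj_on_def)
    ultimately show ?thesis by (simp add: card_image)
  qed
  have "(\<Sum>n=1..N. moebius_mu n * real (N div n)) = (\<Sum>n=1..N. \<Sum>k\<in>{k\<in>{1..N}. n dvd k}. moebius_mu n)"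
    by (intro sum.cong) (simp_all add: card[simplified])
  also have "\<dots> = (\<Sum>k=1..N. \<Sum>n\<in>{n\<in>{1..N}. n dvd k}. moebius_mu n)"
    by (rule sum.swap_restrict) auto
  also have "\<dots> = (\<Sum>k=1..N. \<Sum>n | n dvd k. moebius_mu n)"
    by (intro sum.cong) (auto dest: dvd_imp_le intro!: Nat.gr0I)
  also have "\<dots> = (\<Sum>k=1..N. if k = 1 then 1 else 0)"
    by (intro sum.cong sum_moebius_mu_divisors) auto
  also have "\<dots> = 1" using N by simp
  finally show ?thesis .
qed

text \<open>Replacing \<open>N div n\<close> by N / n costs at most 1 for each n, and nothing at n =
  1. Hence N times the sum differs from 1 by at most N - 1; the exact term n = 1 is what makes the
  final bound 1.\<close>

lemma abs_sum_moebius_mu_over_le: "\<bar>\<Sum>n=1..N. moebius_mu n / real n\<bar> \<le> 1"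
proof (cases "N = 0")
  case False
  define S where "S = (\<Sum>n=1..N. moebius_mu n / real n)"
  have "real N * S - 1 = (\<Sum>n=1..N. moebius_mu n * (real N / real n - real (N div n)))"
    using sum_moebius_mu_div[of N] False
    by (simp add: S_def sum_distrib_left right_diff_distrib sum_subtractf mult_ac)
  also have "\<bar>\<dots>\<bar> \<le> (\<Sum>n=1..N. \<bar>moebius_mu n * (real N / real n - real (N div n))\<bar>)"
    by (rule sum_abs)
  also have "\<dots> \<le> (\<Sum>n=1..N. if n = 1 then 0 else 1)"
  proof (rule sum_mono)
    fix n assume n: "n \<in> {1..N}"
    have "real N / real n - real (N div n) = real (N mod n) / real n"
      using n by (simp add: field_simps flip: of_nat_mult of_nat_add)
    also have "\<dots> \<in> {0..if n = 1 then 0 else 1}" using n by (auto simp: less_imp_le)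
    finally have *: "real N / real n - real (N div n) \<in> {0..if n = 1 then 0 else 1}" .
    show "\<bar>moebius_mu n * (real N / real n - real (N div n))\<bar> \<le> (if n = 1 then 0 else 1)"
      unfolding abs_mult using * abs_moebius_mu_le[of n]
        mult_mono[of "\<bar>moebius_mu n\<bar>" 1 "\<bar>real N / real n - real (N div n)\<bar>" "if n = 1 then 0 else 1"]
      by auto
  qed
  also have "\<dots> = (\<Sum>n\<in>{1..N} - {1}. 1)"
    by (intro sum.mono_neutral_cong_right) auto
  also have "\<dots> = real N - 1" using False by simp
  finally have "\<bar>real N * S\<bar> \<le> real N" by simp
  then show ?thesis using False by (simp add: abs_mult S_def)
qed simp

section \<open>The zeta function on the line of real part 1\<close>

definition zeta_term :: "nat \<Rightarrow> complex \<Rightarrow> complex" where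
  "zeta_term n s = (s - 1) * of_nat (Suc n) powr - s
     + (of_nat (Suc (Suc n)) powr (1 - s) - of_nat (Suc n) powr (1 - s))"

text \<open>\<open>zeta_reg\<close> is $(s - 1) \zeta(s)$: the power differences in \<open>zeta_term\<close> telescope to $-1$ when
  $\Re s > 1$, and they make the terms small enough for convergence on $\Re s > 0$.\<close>

definition zeta_reg :: "complex \<Rightarrow> complex" where
  "zeta_reg s = 1 + (\<Sum>n. zeta_term n s)"

lemma norm_nat_powr: "n > 0 \<Longrightarrow> norm (of_nat n powr s :: complex) = real n powr Re s"
  using norm_powr_real_powr[of "of_nat n" s] by simp

text \<open>Up to the factor s - 1, the term is the difference between the value of z^(-s) at the
  left endpoint N and its integral over [N, N + 1]. The mean value bound, used once for z^(-s) and
  once for \<open>G\<close>, gains the extra power of N that gives convergence for Re s > 0.\<close>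

lemma zeta_term_bound:
  assumes "Re s > 0"
  shows "norm (zeta_term n s) \<le> norm (s - 1) * norm s * real (Suc n) powr (- Re s - 1)"
proof -
  define N where "N = complex_of_nat (Suc n)"
  define S where "S = closed_segment N (N + 1)"
  have S: "Re z \<ge> real (Suc n)" "z \<in> \<real>" "norm (z - N) \<le> 1" if z: "z \<in> S" for z
  proof -
    from that obtain u where u: "0 \<le> u" "u \<le> 1" "z = (1 - u) *\<^sub>R N + u *\<^sub>R (N + 1)"
      by (auto simp: S_def in_segment)
    then have eq: "z = N + of_real u" by (simp add: scaleR_conv_of_real algebra_simps)
    show "Re z \<ge> real (Suc n)" "z \<in> \<real>" "norm (z - N) \<le> 1"
      unfolding eq using u(1,2) by (auto simp: N_def)
  qed
  have nonpos: "z \<notin> \<real>\<^sub>\<le>\<^sub>0" if "z \<in> S" for z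
    using S(1)[OF that] by (auto simp: complex_nonpos_Reals_iff)
  have NS: "N \<in> S" "N + 1 \<in> S" by (auto simp: S_def)
  have powr_diff: "norm (z powr - s - N powr - s) \<le> norm s * real (Suc n) powr (- Re s - 1)"
    if "z \<in> S" for z
  proof -
    have "norm (z powr - s - N powr - s) \<le> norm s * real (Suc n) powr (- Re s - 1) * norm (z - N)"
    proof (rule field_differentiable_bound[of S])
      show "convex S" by (simp add: S_def)
      show "((\<lambda>z. z powr - s) has_field_derivative - s * w powr (- s - 1)) (at w within S)" if "w \<in> S" for w
        using has_field_derivative_powr[OF nonpos[OF that], of "- s"]
        by (rule has_field_derivative_at_within)
      show "norm (- s * w powr (- s - 1)) \<le> norm s * real (Suc n) powr (- Re s - 1)" if "w \<in> S" for w
      proof -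
        have "norm (w powr (- s - 1)) = Re w powr (- Re s - 1)"
          using S(1,2)[OF that] by (subst norm_powr_real_powr) auto
        also have "\<dots> \<le> real (Suc n) powr (- Re s - 1)"
          using S(1)[OF that] assms by (intro powr_mono2') auto
        finally show ?thesis by (simp add: norm_mult mult_left_mono)
      qed
    qed (use that NS in auto)
    also have "\<dots> \<le> norm s * real (Suc n) powr (- Re s - 1) * 1"
      using S(3)[OF that] by (intro mult_left_mono) auto
    finally show ?thesis by simp
  qed
  \<comment> \<open>\<open>G\<close> is built so that its increment over the segment is the term,
    while its derivative (1 - s) (z^(-s) - N^(-s)) is controlled by
    \<open>powr_diff\<close>.\<close>
  define G where "G = (\<lambda>z. z powr (1 - s) + (s - 1) * z * N powr - s)"
  have "norm (G (N + 1) - G N) \<le>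
          norm (s - 1) * (norm s * real (Suc n) powr (- Re s - 1)) * norm (N + 1 - N)"
  proof (rule field_differentiable_bound[of S])
    show "convex S" by (simp add: S_def)
    show "(G has_field_derivative (1 - s) * w powr - s + (s - 1) * N powr - s) (at w within S)"
      if "w \<in> S" for w
      unfolding G_def
      using nonpos[OF that] by (auto intro!: derivative_eq_intros)
    show "norm ((1 - s) * w powr - s + (s - 1) * N powr - s) \<le>
        norm (s - 1) * (norm s * real (Suc n) powr (- Re s - 1))" if "w \<in> S" for w
    proof -
      have "(1 - s) * w powr - s + (s - 1) * N powr - s = (1 - s) * (w powr - s - N powr - s)"
        by (simp add: algebra_simps)
      then show ?thesis
        using powr_diff[OF that] by (simp add: norm_mult norm_minus_commute mult_left_mono)
    qed
  qed (use NS in auto)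
  moreover have "G (N + 1) - G N = zeta_term n s"
    by (simp add: G_def zeta_term_def N_def algebra_simps)
  ultimately show ?thesis by simp
qed

lemma summable_nat_powr:
  assumes "a < - 1"
  shows "summable (\<lambda>n. real (Suc n) powr a)"
  using assms summable_Suc_iff[of "\<lambda>n. real n powr a"] by (simp add: summable_real_powr_iff)

lemma holomorphic_zeta_reg: "zeta_reg holomorphic_on {s. Re s > 0}"
proof (rule holomorphic_uniform_sequence)
  show "open {s. Re s > 0}" by (rule open_halfspace_Re_gt)
  show "(\<lambda>s. 1 + (\<Sum>n<N. zeta_term n s)) holomorphic_on {s. Re s > 0}" for N
    unfolding zeta_term_def by (intro holomorphic_intros)
  fix z :: complex assume "z \<in> {s. Re s > 0}"
  then have z: "Re z > 0" by simp
  \<comment> \<open>Half the distance from z to the imaginary axis: Re s >= d on the closed disc, so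
    the M-test can use the majorant n^(-d-1).\<close>
  define d where "d = Re z / 2"
  define R where "R = norm z + d"
  have d: "d > 0" using z by (simp add: d_def)
  have R: "R > 0" using d by (simp add: R_def add_nonneg_pos)
  have near: "Re s \<ge> d" "norm s \<le> R" if "s \<in> cball z d" for s
  proof -
    have "norm (z - s) \<le> d" using that by (simp add: dist_norm)
    then have "\<bar>Re (z - s)\<bar> \<le> d" using abs_Re_le_cmod order_trans by blast
    then have "\<bar>Re z - Re s\<bar> \<le> d" by simp
    then show "Re s \<ge> d" unfolding d_def by linarith
    show "norm s \<le> R" using \<open>norm (z - s) \<le> d\<close> norm_triangle_ineq2[of s z]
      by (simp add: R_def norm_minus_commute)
  qed
  have "uniform_limit (cball z d) (\<lambda>N s. \<Sum>n<N. zeta_term n s) (\<lambda>s. \<Sum>n. zeta_term n s) sequentially"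
  proof (rule Weierstrass_m_test)
    show "norm (zeta_term n s) \<le> (R + 1) * R * real (Suc n) powr (- d - 1)" if "s \<in> cball z d" for n s
    proof -
      have "norm (zeta_term n s) \<le> norm (s - 1) * norm s * real (Suc n) powr (- Re s - 1)"
        using near[OF that] d by (intro zeta_term_bound) auto
      also have "\<dots> \<le> (R + 1) * R * real (Suc n) powr (- d - 1)"
        using near[OF that] R norm_triangle_ineq4[of s 1]
        by (intro mult_mono powr_mono) auto
      finally show ?thesis .
    qed
    show "summable (\<lambda>n. (R + 1) * R * real (Suc n) powr (- d - 1))"
      using d by (intro summable_mult summable_nat_powr) auto
  qed
  then have "uniform_limit (cball z d) (\<lambda>N s. 1 + (\<Sum>n<N. zeta_term n s)) zeta_reg sequentially"
    unfolding zeta_reg_def by (intro uniform_limit_intros) auto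
  then show "\<exists>d>0. cball z d \<subseteq> {s. Re s > 0} \<and>
      uniform_limit (cball z d) (\<lambda>N s. 1 + (\<Sum>n<N. zeta_term n s)) zeta_reg sequentially"
    using d near by (intro exI[of _ d]) (force)
qed

text \<open>The value is the residue of zeta at 1. It covers the one point of the line Re s = 1
  where the 3-4-1 argument does not apply.\<close>

lemma zeta_reg_1: "zeta_reg 1 = 1"
  by (simp add: zeta_reg_def zeta_term_def del: of_nat_Suc)

lemma summable_norm_zeta:
  assumes "Re s > 1"
  shows "summable (\<lambda>n. norm (of_nat n powr - s :: complex))"
proof -
  have "summable (\<lambda>n. norm (of_nat (Suc n) powr - s :: complex))"
    using assms by (subst norm_nat_powr) (auto intro!: summable_nat_powr simp del: of_nat_Suc)
  then show ?thesis by (subst (asm) summable_Suc_iff)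
qed

lemma zeta_reg_eq:
  assumes "Re s > 1"
  shows "zeta_reg s = (s - 1) * (\<Sum>n. of_nat n powr - s)"
proof -
  have sm: "summable (\<lambda>n. of_nat n powr - s :: complex)"
    using summable_norm_zeta[OF assms] by (rule summable_norm_cancel)
  have "(\<lambda>n. of_nat (Suc n) powr - s) sums ((\<Sum>n. of_nat n powr - s :: complex))"
    using sums_Suc_iff[of "\<lambda>n. of_nat n powr - s :: complex"] summable_sums[OF sm] by simp
  then have 1: "(\<lambda>n. (s - 1) * of_nat (Suc n) powr - s) sums ((s - 1) * (\<Sum>n. of_nat n powr - s))"
    by (rule sums_mult)
  have "(\<lambda>n. of_nat (Suc n) powr (1 - s) :: complex) \<longlonglongrightarrow> 0"
  proof (rule tendsto_norm_zero_cancel)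
    have "(\<lambda>n. real (Suc n) powr (1 - Re s)) \<longlonglongrightarrow> 0"
      using assms by real_asymp
    then show "(\<lambda>n. norm (of_nat (Suc n) powr (1 - s) :: complex)) \<longlonglongrightarrow> 0"
      by (subst norm_nat_powr) auto
  qed
  from telescope_sums[OF this]
  have "(\<lambda>n. of_nat (Suc (Suc n)) powr (1 - s) - of_nat (Suc n) powr (1 - s) :: complex) sums (- 1)"
    by simp
  from sums_add[OF 1 this] have "(\<lambda>n. zeta_term n s) sums ((s - 1) * (\<Sum>n. of_nat n powr - s) + - 1)"
    by (simp add: zeta_term_def)
  then show ?thesis by (simp add: zeta_reg_def sums_unique[symmetric])
qed

section \<open>Euler product and Moebius series for Re s > 1\<close>

lemma of_nat_powr_mult: "of_nat (m * n) powr s = of_nat m powr s * (of_nat n powr s :: complex)"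
  using powr_times_real_left[of "of_nat m" "of_nat n" s] by simp

text \<open>The index set beyond N is arbitrary: the sieve and the expanded Euler product leave
  remainders over different sets, and both are controlled by the tail of the same convergent series
  of norms.\<close>

lemma norm_infsum_le_tail:
  fixes f :: "nat \<Rightarrow> 'a :: banach"
  assumes g: "g summable_on UNIV" and le: "\<And>n. norm (f n) \<le> g n"
    and A: "A \<subseteq> {N<..}"
  shows "norm (infsum f A) \<le> infsum g UNIV - sum g {..N}"
proof -
  have g0: "g n \<ge> 0" for n using norm_ge_zero[of "f n"] le[of n] by linarith
  have gs: "g summable_on B" for B using summable_on_subset_banach[OF g] by auto
  have f: "(\<lambda>n. norm (f n)) summable_on B" for B
    using gs[of B] le by (rule Infinite_Sum.abs_summable_on_comparison_test')
  have "norm (infsum f A) \<le> infsum (\<lambda>n. norm (f n)) A"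
    using f by (rule norm_infsum_bound)
  also have "\<dots> \<le> infsum g A" using f gs le by (intro infsum_mono) auto
  also have "\<dots> \<le> infsum g {N<..}"
    using gs A g0 by (intro infsum_mono_neutral) auto
  also have "\<dots> = infsum g UNIV - sum g {..N}"
  proof -
    have "infsum g ({..N} \<union> {N<..}) = infsum g {..N} + infsum g {N<..}"
      using gs by (intro infsum_Un_disjoint) auto
    moreover have "{..N} \<union> {N<..} = UNIV" by auto
    ultimately show ?thesis by simp
  qed
  finally show ?thesis .
qed

lemma infsum_tail_tendsto_0:
  fixes g :: "nat \<Rightarrow> real"
  assumes "g summable_on UNIV"
  shows "(\<lambda>N. infsum g UNIV - sum g {..N}) \<longlonglongrightarrow> 0"
proof -
  have "g sums infsum g UNIV"
    using assms by (simp add: has_sum_infsum has_sum_imp_sums)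
  then have "(\<lambda>N. sum g {..N}) \<longlonglongrightarrow> infsum g UNIV" by (simp add: sums_def_le)
  from tendsto_diff[OF tendsto_const[of "infsum g UNIV"] this] show ?thesis by simp
qed

text \<open>One point s of absolute convergence is fixed, so that the construction can be
  instantiated at the three points of the 3-4-1 inequality. \<open>E\<close> is a finite Euler
  product for 1/zeta. It serves twice: its limit identifies 1/zeta with the Moebius series, and its
  factors are what the inequality estimates.\<close>

locale zeta_abs_conv =
  fixes s :: complex
  assumes Re_s: "Re s > 1"
begin

definition f :: "nat \<Rightarrow> complex" where "f n = of_nat n powr - s"
definition E :: "nat set \<Rightarrow> complex" where "E P = (\<Prod>p\<in>P. 1 - f p)"
definition zeta :: complex where "zeta = (\<Sum>n. f n)"

text \<open>Since 0 raised to any power is 0 for \<open>powr\<close>, series may run over all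
  natural numbers without excluding 0.\<close>

lemma f_0 [simp]: "f 0 = 0" and f_1 [simp]: "f (Suc 0) = 1" by (simp_all add: f_def)

lemma f_mult: "f (m * n) = f m * f n"
  unfolding f_def by (rule of_nat_powr_mult)

lemma norm_f_summable: "(\<lambda>n. norm (f n)) summable_on UNIV"
  unfolding f_def using summable_norm_zeta[OF Re_s] by (simp add: summable_on_UNIV_nonneg_real_iff)

lemma f_summable_on: "f summable_on A"
  using norm_summable_imp_summable_on[OF summable_norm_zeta[OF Re_s]] summable_on_subset_banach
  unfolding f_def by blast

lemma zeta_eq: "zeta = infsum f UNIV"
  unfolding zeta_def using has_sum_imp_sums[OF has_sum_infsum[OF f_summable_on]]
  by (simp add: sums_iff)

text \<open>The sieve of Eratosthenes. The multiples of a new prime p among the numbers sifted so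
  far form p times the sifted set, since p is divisible by none of the earlier primes; by complete
  multiplicativity, removing them multiplies the sum by 1 - f p.\<close>

lemma sifted_sum:
  assumes "finite P" "\<And>p. p \<in> P \<Longrightarrow> prime p"
  shows "infsum f {n. \<forall>p\<in>P. \<not> p dvd n} = zeta * E P"
  using assms
proof (induction P rule: finite_induct)
  case empty
  then show ?case by (simp add: zeta_eq E_def)
next
  case (insert p P)
  let ?A = "{n. \<forall>p\<in>P. \<not> p dvd n}"
  have p: "prime p" "p > 0" using insert by (auto intro: prime_gt_0_nat)
  have nd: "\<not> q dvd p" if "q \<in> P" for q
    using primes_dvd_imp_eq[of q p] insert that p by auto
  have sub: "(\<lambda>n. p * n) ` ?A \<subseteq> ?A"
    using insert p nd by (auto simp: prime_dvd_mult_iff)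
  have "{n. \<forall>q\<in>insert p P. \<not> q dvd n} = ?A - (\<lambda>n. p * n) ` ?A"
  proof (intro equalityI subsetI)
    fix n assume n: "n \<in> ?A - (\<lambda>n. p * n) ` ?A"
    have "\<not> p dvd n"
    proof
      assume "p dvd n"
      then obtain k where k: "n = p * k" by (elim dvdE)
      then have "k \<in> ?A" using n by (auto intro: dvd_mult)
      then show False using n k by auto
    qed
    then show "n \<in> {n. \<forall>q\<in>insert p P. \<not> q dvd n}" using n by simp
  qed auto
  then have "infsum f {n. \<forall>q\<in>insert p P. \<not> q dvd n} = infsum f ?A - infsum f ((\<lambda>n. p * n) ` ?A)"
    using sub by (simp only:) (intro infsum_Diff f_summable_on)
  also have "infsum f ((\<lambda>n. p * n) ` ?A) = infsum (\<lambda>n. f p * f n) ?A"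
    using p by (subst infsum_reindex) (auto simp: inj_on_def f_mult o_def)
  also have "\<dots> = f p * infsum f ?A"
    by (rule infsum_cmult_right) (intro f_summable_on)
  finally show ?case using insert by (simp add: E_def algebra_simps)
qed

definition primes_le :: "nat \<Rightarrow> nat set" where "primes_le N = {p. prime p \<and> p \<le> N}"

lemma finite_primes_le [simp]: "finite (primes_le N)"
  by (rule finite_subset[of _ "{..N}"]) (auto simp: primes_le_def)

text \<open>After sifting by all primes up to N, every remaining number except 0 and 1 has a prime
  factor above N and so exceeds N itself.\<close>

lemma zeta_mult_E_tendsto: "(\<lambda>N. zeta * E (primes_le N)) \<longlonglongrightarrow> 1"
proof (rule LIM_zero_cancel, rule Lim_null_comparison[OF always_eventually infsum_tail_tendsto_0[OF norm_f_summable]], rule allI)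
  fix N
  let ?A = "{n. \<forall>p\<in>primes_le N. \<not> p dvd n}"
  have "zeta * E (primes_le N) = infsum f ?A"
    by (subst sifted_sum) (auto simp: primes_le_def)
  \<comment> \<open>The index 0 survives the sieve only if there is no prime up to N; its term is 0
    in any case.\<close>
  also have "\<dots> = infsum f (?A - {0})"
    by (rule infsum_cong_neutral) auto
  also have "?A - {0} = {1} \<union> (?A - {0, 1})"
    by (auto simp: primes_le_def)
  also have "infsum f \<dots> = infsum f {1} + infsum f (?A - {0, 1})"
    by (intro infsum_Un_disjoint f_summable_on) auto
  finally have "zeta * E (primes_le N) - 1 = infsum f (?A - {0, 1})" by simp
  moreover have "?A - {0, 1} \<subseteq> {N<..}"
  proof
    fix n assume n: "n \<in> ?A - {0, 1}"
    then obtain p where "prime p" "p dvd n" using prime_factor_nat[of n] by auto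
    then have "p > N" "p \<le> n" using n dvd_imp_le[of p n] by (force simp: primes_le_def)+
    then show "n \<in> {N<..}" by simp
  qed
  ultimately show "norm (zeta * E (primes_le N) - 1) \<le> infsum (\<lambda>n. norm (f n)) UNIV - (\<Sum>n\<le>N. norm (f n))"
    using norm_infsum_le_tail[OF norm_f_summable, of f] by simp
qed

text \<open>Multiplying out the product yields (-1)^|T| f(prod T) for each set T of primes, and the
  sign is the Moebius value of that product.\<close>

lemma E_eq_sum:
  assumes "finite P" "\<And>p. p \<in> P \<Longrightarrow> prime p"
  shows "E P = (\<Sum>n\<in>\<Prod> ` Pow P. of_real (moebius_mu n) * f n)"
proof -
  have prod_f: "finite T \<Longrightarrow> (\<Prod>p\<in>T. f p) = f (\<Prod>T)" for T
    by (induction T rule: finite_induct) (simp_all add: f_mult)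
  have "E P = (\<Sum>T\<in>Pow P. (- 1) ^ card T * (\<Prod>p\<in>T. f p))"
    unfolding E_def using assms by (simp add: prod_diff_conv_sum)
  also have "\<dots> = (\<Sum>T\<in>Pow P. of_real (moebius_mu (\<Prod>T)) * f (\<Prod>T))"
    using assms by (intro sum.cong refl, subst moebius_mu_prod_primes)
      (auto simp: prod_f dest: finite_subset)
  finally show ?thesis
    using assms by (simp add: sum.reindex inj_on_prod_primes)
qed

lemma norm_moebius_f: "norm (of_real (moebius_mu n) * f n) \<le> norm (f n)"
  using abs_moebius_mu_le[of n] by (simp add: norm_mult mult_left_le_one_le)

lemma moebius_f_abs_summable: "(\<lambda>n. norm (of_real (moebius_mu n) * f n)) summable_on UNIV"
  using norm_f_summable norm_moebius_f by (rule Infinite_Sum.abs_summable_on_comparison_test')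

text \<open>The expanded product contains every squarefree n up to N, since its prime factors are at
  most N. What is missing from the full series is either not squarefree, with coefficient 0, or lies
  beyond N.\<close>

lemma E_tendsto: "(\<lambda>N. E (primes_le N)) \<longlonglongrightarrow> (\<Sum>n. of_real (moebius_mu n) * f n)"
proof (rule LIM_zero_cancel, rule Lim_null_comparison[OF always_eventually infsum_tail_tendsto_0[OF norm_f_summable]], rule allI)
  fix N
  let ?g = "\<lambda>n. of_real (moebius_mu n) * f n"
  let ?B = "\<Prod> ` Pow (primes_le N)"
  have sm: "?g summable_on A" for A
    using Infinite_Sum.abs_summable_summable[OF moebius_f_abs_summable] summable_on_subset_banach
    by blast
  have "(\<Sum>n. ?g n) = infsum ?g UNIV"
    using has_sum_imp_sums[OF has_sum_infsum[OF sm]] by (simp add: sums_iff)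
  also have "UNIV = ?B \<union> - ?B" by auto
  also have "infsum ?g \<dots> = infsum ?g ?B + infsum ?g (- ?B)"
    by (intro infsum_Un_disjoint sm) auto
  also have "infsum ?g ?B = E (primes_le N)"
    by (subst E_eq_sum) (auto simp: primes_le_def[of N])
  also have "infsum ?g (- ?B) = infsum ?g (- ?B \<inter> {N<..})"
  proof (rule infsum_cong_neutral)
    fix n assume n: "n \<in> - ?B - - ?B \<inter> {N<..}"
    have "\<not> squarefree n"
    proof
      assume sf: "squarefree n"
      then have "n > 0" by (metis not_squarefree_0 gr0I)
      then have "prime_factors n \<in> Pow (primes_le N)"
        using n by (auto simp: primes_le_def prime_factors_dvd dest: dvd_imp_le)
      then have "n \<in> ?B" using squarefree_eq_prod_prime_factors[OF sf] by (metis imageI)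
      then show False using n by auto
    qed
    then show "?g n = 0" by (simp add: moebius_mu_def)
  qed auto
  finally have "E (primes_le N) - (\<Sum>n. ?g n) = - infsum ?g (- ?B \<inter> {N<..})" by simp
  then show "norm (E (primes_le N) - (\<Sum>n. ?g n)) \<le> infsum (\<lambda>n. norm (f n)) UNIV - (\<Sum>n\<le>N. norm (f n))"
    using norm_infsum_le_tail[OF norm_f_summable norm_moebius_f, of "- ?B \<inter> {N<..}" N] by simp
qed

lemma zeta_mult_moebius: "zeta * (\<Sum>n. of_real (moebius_mu n) * f n) = 1"
  using tendsto_mult_left[OF E_tendsto, of zeta] zeta_mult_E_tendsto LIMSEQ_unique by blast

end

section \<open>The 3-4-1 inequality and non-vanishing on the line Re s = 1\<close>

lemma ln_cmod_sums:
  fixes z :: complex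
  assumes "norm z < 1"
  shows "(\<lambda>n. - Re (z ^ n) / real n) sums ln (norm (1 - z))"
proof -
  have "(\<lambda>n. (- 1) ^ Suc n / of_nat n * (- z) ^ n) sums Ln (1 + (- z))"
    using assms by (intro Ln_series) auto
  \<comment> \<open>Division by zero makes the terms of index 0 vanish on both sides, so the
    logarithm series may be indexed from 0.\<close>
  moreover have "(- 1) ^ Suc n / of_nat n * (- z) ^ n = - (z ^ n) / of_nat n" for n
    by (cases "even n") simp_all
  ultimately have "(\<lambda>n. - (z ^ n) / of_nat n) sums Ln (1 - z)"
    by (simp only: add_uminus_conv_diff)
  moreover have "z \<noteq> 1" using assms by auto
  ultimately show ?thesis
    using sums_Re by (fastforce simp: Re_divide_of_nat Re_Ln)
qed

text \<open>The logarithm of the product is $- \sum_n (r^n/n) (3 + 4 \Re u^n + \Re u^{2n})$, and each bracket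
  equals $2 (1 + \Re u^n)^2$.\<close>

lemma euler_factor_341:
  fixes u :: complex and r :: real
  assumes r: "0 \<le> r" "r < 1" and u: "norm u = 1"
  shows "norm (1 - complex_of_real r) ^ 3 * norm (1 - of_real r * u) ^ 4 * norm (1 - of_real r * u\<^sup>2) \<le> 1"
proof -
  let ?a = "norm (1 - complex_of_real r)" and ?b = "norm (1 - of_real r * u)"
    and ?c = "norm (1 - of_real r * u\<^sup>2)"
  have nz: "norm (1 - of_real r * w) > 0" if "norm w = 1" for w :: complex
  proof -
    have "norm (of_real r * w) = r" using r that by (simp add: norm_mult)
    moreover have "norm (1 :: complex) = 1" by simp
    ultimately show ?thesis using norm_triangle_ineq2[of 1 "of_real r * w"] r by linarith
  qed
  have pos: "?a > 0" "?b > 0" "?c > 0"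
    using nz[of 1] nz[of u] nz[of "u\<^sup>2"] u by (auto simp: norm_power)
  have s: "norm (complex_of_real r) < 1" "norm (of_real r * u) < 1" "norm (of_real r * u\<^sup>2) < 1"
    using r u by (auto simp: norm_mult norm_power)
  from sums_add[OF sums_add[OF sums_mult[OF ln_cmod_sums[OF s(1)], of 3]
      sums_mult[OF ln_cmod_sums[OF s(2)], of 4]] ln_cmod_sums[OF s(3)]]
  have "3 * ln ?a + 4 * ln ?b + ln ?c \<le> 0"
  proof (rule sums_le[OF _ _ sums_zero, rotated])
    fix n
    define w where "w = u ^ n"
    have "norm w = 1" using u by (simp add: w_def norm_power)
    then have w: "(Re w)\<^sup>2 + (Im w)\<^sup>2 = 1" by (simp add: cmod_def)
    have "Re (w\<^sup>2) = 2 * (Re w)\<^sup>2 - 1"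
      using w by (simp add: power2_eq_square)
    then have "3 + 4 * Re w + Re (w\<^sup>2) = 2 * (Re w + 1)\<^sup>2"
      by (simp add: power2_eq_square algebra_simps)
    then have nn: "3 + 4 * Re w + Re (w\<^sup>2) \<ge> 0" by simp
    have *: "Re (complex_of_real r ^ n) = r ^ n" "Re ((of_real r * u) ^ n) = r ^ n * Re w"
        "Re ((of_real r * u\<^sup>2) ^ n) = r ^ n * Re (w\<^sup>2)"
    proof -
      show "Re (complex_of_real r ^ n) = r ^ n" by (simp flip: of_real_power)
      have "(of_real r * u) ^ n = of_real (r ^ n) * w" by (simp add: w_def power_mult_distrib)
      then show "Re ((of_real r * u) ^ n) = r ^ n * Re w" by (simp only: times_complex.sel Re_complex_of_real Im_complex_of_real)
      have "(u\<^sup>2) ^ n = w\<^sup>2" by (simp add: w_def mult.commute flip: power_mult)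
      then have "(of_real r * u\<^sup>2) ^ n = of_real (r ^ n) * w\<^sup>2" by (simp add: power_mult_distrib)
      then show "Re ((of_real r * u\<^sup>2) ^ n) = r ^ n * Re (w\<^sup>2)" by (simp only: times_complex.sel Re_complex_of_real Im_complex_of_real)
    qed
    have "3 * (- Re (complex_of_real r ^ n) / real n) + 4 * (- Re ((of_real r * u) ^ n) / real n)
        + - Re ((of_real r * u\<^sup>2) ^ n) / real n = - (r ^ n * (3 + 4 * Re w + Re (w\<^sup>2)) / real n)"
      unfolding *(1-3) by (simp add: add_divide_distrib diff_divide_distrib algebra_simps)
    also have "\<dots> \<le> 0" using nn r by simp
    finally show "3 * (- Re (complex_of_real r ^ n) / real n) + 4 * (- Re ((of_real r * u) ^ n) / real n)
        + - Re ((of_real r * u\<^sup>2) ^ n) / real n \<le> 0" .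
  qed
  then have "ln (?a ^ 3 * ?b ^ 4 * ?c) \<le> 0"
    using pos by (simp add: ln_mult ln_realpow)
  moreover have "?a ^ 3 * ?b ^ 4 * ?c > 0" using pos by simp
  ultimately show ?thesis by (simp add: ln_le_zero_iff)
qed

lemma moebius_series_eq:
  assumes "Re s > 1"
  shows "zeta_reg s \<noteq> 0"
    and "(\<Sum>n. of_real (moebius_mu n) * of_nat n powr - s) = (s - 1) / zeta_reg s"
proof -
  interpret zeta_abs_conv s by standard fact
  let ?M = "\<Sum>n. of_real (moebius_mu n) * of_nat n powr - s"
  have 1: "zeta * ?M = 1" using zeta_mult_moebius by (simp add: f_def)
  have 2: "zeta_reg s = (s - 1) * zeta" using zeta_reg_eq[OF assms] by (simp add: zeta_def f_def)
  have "s \<noteq> 1" using assms by auto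
  with 1 2 show "zeta_reg s \<noteq> 0" by auto
  then have "zeta \<noteq> 0" "s - 1 \<noteq> 0" using 2 by auto
  then show "?M = (s - 1) / zeta_reg s" using 1 unfolding 2 by (simp add: field_simps)
qed

text \<open>At the points \<sigma>, \<sigma> + i t, \<sigma> + 2 i t the prime p contributes r, r u,
  r u^2 with r = p^(-\<sigma>) and u = p^(-i t), so \<open>euler_factor_341\<close> bounds each
  Euler factor and the limit bounds the Moebius series. The factors on the left come from 1/zeta(s)
  = (s - 1) / zeta_reg(s) at the three points.\<close>

lemma zeta_reg_341:
  fixes \<sigma> t :: real
  assumes "\<sigma> > 1"
  shows "(\<sigma> - 1) ^ 3 * norm (Complex (\<sigma> - 1) t) ^ 4 * norm (Complex (\<sigma> - 1) (2 * t)) \<le>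
    norm (zeta_reg (of_real \<sigma>)) ^ 3 * norm (zeta_reg (Complex \<sigma> t)) ^ 4
      * norm (zeta_reg (Complex \<sigma> (2 * t)))"
proof -
  interpret z0: zeta_abs_conv "of_real \<sigma>" by standard (use assms in simp)
  interpret z1: zeta_abs_conv "Complex \<sigma> t" by standard (use assms in simp)
  interpret z2: zeta_abs_conv "Complex \<sigma> (2 * t)" by standard (use assms in simp)
  have factor: "norm (1 - z0.f p) ^ 3 * norm (1 - z1.f p) ^ 4 * norm (1 - z2.f p) \<le> 1" if "prime p" for p
  proof -
    define r u where "r = real p powr - \<sigma>" and "u = complex_of_nat p powr - (\<i> * of_real t)"
    have p: "p > 1" using that by (rule prime_gt_1_nat)
    have r: "0 \<le> r" "r < 1" using p assms by (auto simp: r_def powr_less_one)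
    have u: "norm u = 1" using p by (simp add: u_def norm_nat_powr)
    have f0: "z0.f p = of_real r"
      using p by (simp add: z0.f_def r_def powr_of_real[symmetric])
    have "- Complex \<sigma> t = - of_real \<sigma> + - (\<i> * of_real t)" by (simp add: complex_eq_iff)
    then have f1: "z1.f p = of_real r * u"
      by (simp only: f0[symmetric] z0.f_def z1.f_def u_def powr_add)
    have "- Complex \<sigma> (2 * t) = - of_real \<sigma> + (- (\<i> * of_real t) + - (\<i> * of_real t))"
      by (simp add: complex_eq_iff)
    then have f2: "z2.f p = of_real r * u\<^sup>2"
      by (simp only: f0[symmetric] z0.f_def z2.f_def u_def powr_add power2_eq_square)
    show ?thesis using euler_factor_341[OF r u] by (simp only: f0 f1 f2)
  qed
  let ?P = "\<lambda>N. {p. prime p \<and> p \<le> (N::nat)}"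
  have pr: "z0.primes_le N = ?P N" "z1.primes_le N = ?P N" "z2.primes_le N = ?P N" for N
    by (simp_all add: z0.primes_le_def z1.primes_le_def z2.primes_le_def)
  have le: "norm (z0.E (?P N)) ^ 3 * norm (z1.E (?P N)) ^ 4 * norm (z2.E (?P N)) \<le> 1" for N
  proof -
    have "norm (z0.E (?P N)) ^ 3 * norm (z1.E (?P N)) ^ 4 * norm (z2.E (?P N)) =
        (\<Prod>p\<in>?P N. norm (1 - z0.f p) ^ 3 * norm (1 - z1.f p) ^ 4 * norm (1 - z2.f p))"
      by (simp only: z0.E_def z1.E_def z2.E_def prod.distrib prod_power_distrib prod_norm[symmetric])
    also have "\<dots> \<le> 1"
      using factor by (intro prod_le_1) auto
    finally show ?thesis .
  qed
  define M where "M = (\<lambda>s. \<Sum>n. of_real (moebius_mu n) * complex_of_nat n powr - s)"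
  have "norm (M (of_real \<sigma>)) ^ 3 * norm (M (Complex \<sigma> t)) ^ 4 * norm (M (Complex \<sigma> (2 * t))) \<le> 1"
  proof (rule LIMSEQ_le_const2)
    show "(\<lambda>N. norm (z0.E (?P N)) ^ 3 * norm (z1.E (?P N)) ^ 4 * norm (z2.E (?P N))) \<longlonglongrightarrow>
      norm (M (of_real \<sigma>)) ^ 3 * norm (M (Complex \<sigma> t)) ^ 4 * norm (M (Complex \<sigma> (2 * t)))"
      using z0.E_tendsto z1.E_tendsto z2.E_tendsto unfolding pr M_def z0.f_def z1.f_def z2.f_def
      by (intro tendsto_intros)
  qed (use le in auto)
  moreover have "norm (M s) = norm (s - 1) / norm (zeta_reg s)" if "Re s > 1" for s
    using moebius_series_eq[OF that] by (simp add: M_def norm_divide)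
  moreover have "norm (complex_of_real \<sigma> - 1) = \<sigma> - 1"
    using assms norm_of_real[of "\<sigma> - 1", where 'a = complex] by simp
  moreover have "Complex \<sigma> t - 1 = Complex (\<sigma> - 1) t" for t by (simp add: complex_eq_iff)
  ultimately have "((\<sigma> - 1) ^ 3 * norm (Complex (\<sigma> - 1) t) ^ 4 * norm (Complex (\<sigma> - 1) (2 * t))) /
    (norm (zeta_reg (of_real \<sigma>)) ^ 3 * norm (zeta_reg (Complex \<sigma> t)) ^ 4
      * norm (zeta_reg (Complex \<sigma> (2 * t)))) \<le> 1"
    using assms by (simp add: power_divide)
  moreover have "norm (zeta_reg (of_real \<sigma>)) ^ 3 * norm (zeta_reg (Complex \<sigma> t)) ^ 4
      * norm (zeta_reg (Complex \<sigma> (2 * t))) > 0"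
    using moebius_series_eq(1) assms by simp
  ultimately show ?thesis by (simp only: divide_le_eq_1_pos)
qed

text \<open>A zero at 1 + i t would make \<open>zeta_reg\<close> at \<sigma> + i t of order \<sigma>
  - 1. Its fourth power beats the cube of \<sigma> - 1 on the left of \<open>zeta_reg_341\<close>,
  which is impossible as \<sigma> tends to 1, because the remaining factors on the left tend to
  |t|^4 |2 t| > 0.\<close>

theorem zeta_reg_nonzero:
  assumes "Re s \<ge> 1"
  shows "zeta_reg s \<noteq> 0"
proof (cases "Re s = 1 \<and> Im s \<noteq> 0")
  case False
  then consider "Re s > 1" | "s = 1" using assms by (force simp: complex_eq_iff)
  then show ?thesis using moebius_series_eq(1) zeta_reg_1 by cases auto
next
  case True
  define t where "t = Im s"
  have t: "t \<noteq> 0" and s: "s = Complex 1 t" using True by (auto simp: t_def complex_eq_iff)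
  define S where "S = {s. Re s > 0}"
  have S: "open S" by (simp add: S_def open_halfspace_Re_gt)
  have hol: "zeta_reg holomorphic_on S" unfolding S_def by (rule holomorphic_zeta_reg)
  have cont: "isCont zeta_reg z" if "Re z > 0" for z
    using holomorphic_on_imp_continuous_on[OF hol] that S
    by (auto simp: continuous_on_eq_continuous_at S_def)
  have lim: "((\<lambda>\<sigma>. zeta_reg (Complex \<sigma> y)) \<longlongrightarrow> zeta_reg (Complex 1 y)) (at_right 1)" for y
    by (rule isCont_tendsto_compose[OF cont]) (auto intro!: tendsto_intros)
  show ?thesis
  proof
    assume zero: "zeta_reg s = 0"
    obtain D where D: "(zeta_reg has_field_derivative D) (at s)"
      using holomorphic_on_imp_differentiable_at[OF hol S, of s] True
      by (auto simp: S_def field_differentiable_def)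
    have "((\<lambda>\<sigma>. zeta_reg (Complex \<sigma> t) / of_real (\<sigma> - 1)) \<longlongrightarrow> D) (at_right 1)"
    proof -
      have "((\<lambda>z. (zeta_reg z - zeta_reg s) / (z - s)) \<longlongrightarrow> D) (at s)"
        using D by (simp add: has_field_derivative_iff)
      moreover have "filterlim (\<lambda>\<sigma>. Complex \<sigma> t) (at s) (at_right 1)"
        unfolding s by (auto simp: filterlim_at eventually_at_filter intro!: tendsto_intros)
      ultimately have "((\<lambda>\<sigma>. (zeta_reg (Complex \<sigma> t) - zeta_reg s) / (Complex \<sigma> t - s)) \<longlongrightarrow> D) (at_right 1)"
        by (rule filterlim_compose)
      moreover have "Complex \<sigma> t - s = of_real (\<sigma> - 1)" for \<sigma> by (simp add: s complex_eq_iff)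
      ultimately show ?thesis by (simp add: zero)
    qed
    note D_lim = this
    \<comment> \<open>Both sides of \<open>zeta_reg_341\<close> divided by (\<sigma> - 1)^3. Four
      powers of \<sigma> - 1 go into the difference quotients on the right, so one factor \<sigma> -
      1 is left over and forces the right side to 0.\<close>
    let ?L = "\<lambda>\<sigma>. norm (Complex (\<sigma> - 1) t) ^ 4 * norm (Complex (\<sigma> - 1) (2 * t))"
    let ?R = "\<lambda>\<sigma>. norm (zeta_reg (Complex \<sigma> 0)) ^ 3 *
      norm (zeta_reg (Complex \<sigma> t) / of_real (\<sigma> - 1)) ^ 4 *
      ((\<sigma> - 1) * norm (zeta_reg (Complex \<sigma> (2 * t))))"
    have L: "(?L \<longlongrightarrow> norm (Complex (1 - 1) t) ^ 4 * norm (Complex (1 - 1) (2 * t))) (at_right 1)"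
      by (intro tendsto_intros)
    have R: "(?R \<longlongrightarrow> norm (zeta_reg (Complex 1 0)) ^ 3 * norm D ^ 4 *
        ((1 - 1) * norm (zeta_reg (Complex 1 (2 * t))))) (at_right 1)"
      by (intro tendsto_intros lim D_lim)
    have "?L \<sigma> \<le> ?R \<sigma>" if "\<sigma> > 1" for \<sigma>
    proof -
      have "(\<sigma> - 1) ^ 3 * ?L \<sigma> \<le> (\<sigma> - 1) ^ 3 * ?R \<sigma>"
      proof -
        have cancel: "h ^ 3 * (A * (B / h) ^ 4 * (h * C)) = A * B ^ 4 * C" if "h > 0" for A B C h :: real
          using that by (simp add: field_simps power_divide eval_nat_numeral)
        have "norm (z / of_real (\<sigma> - 1)) = norm z / (\<sigma> - 1)" for z :: complex
          using that by (simp only: norm_divide norm_of_real)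
        with cancel[of "\<sigma> - 1"] have eq: "(\<sigma> - 1) ^ 3 * ?R \<sigma> = norm (zeta_reg (Complex \<sigma> 0)) ^ 3 *
            norm (zeta_reg (Complex \<sigma> t)) ^ 4 * norm (zeta_reg (Complex \<sigma> (2 * t)))"
          using that by (simp only:)
        show ?thesis
          unfolding eq using zeta_reg_341[OF that, of t] unfolding complex_of_real_def[of \<sigma>]
          by (simp only: mult.assoc)
      qed
      then show ?thesis using that by (simp add: mult_le_cancel_left_pos)
    qed
    then have "eventually (\<lambda>\<sigma>. ?L \<sigma> \<le> ?R \<sigma>) (at_right 1)"
      by (auto simp: eventually_at_filter)
    moreover have "norm (Complex (1 - 1) y) = \<bar>y\<bar>" for y by (simp add: cmod_def)
    ultimately have "\<bar>t\<bar> ^ 4 * \<bar>2 * t\<bar> \<le> 0"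
      using tendsto_le[OF _ R L] by (simp only:) simp
    moreover have "\<bar>t\<bar> ^ 4 * \<bar>2 * t\<bar> > 0" using t by (intro mult_pos_pos) auto
    ultimately show False by linarith
  qed
qed

section \<open>A Tauberian theorem via the Fejer kernel\<close>

text \<open>This is (sin(u/2) / (u/2))^2. At u = 0 division by zero gives 0 instead of the limit 1,
  which affects only a null set.\<close>

definition fejer :: "real \<Rightarrow> real" where
  "fejer u = 2 * (1 - cos u) / u\<^sup>2"

definition hat :: "real \<Rightarrow> real" where
  "hat \<xi> = max 0 (1 - \<bar>\<xi>\<bar>)"

lemma borel_measurable_fejer [measurable]: "fejer \<in> borel_measurable borel"
  unfolding fejer_def by measurable

lemma continuous_on_hat [continuous_intros]: "continuous_on A hat"
  unfolding hat_def by (intro continuous_intros)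

lemma borel_measurable_hat [measurable]: "hat \<in> borel_measurable borel"
  by (intro borel_measurable_continuous_onI continuous_intros)

lemma borel_measurable_cis [measurable]: "cis \<in> borel_measurable borel"
  by (intro borel_measurable_continuous_onI continuous_intros)

lemma hat_bounds: "0 \<le> hat \<xi>" "hat \<xi> \<le> indicator {-1..1} \<xi>"
  by (auto simp: hat_def indicator_def)

lemma fejer_nonneg: "0 \<le> fejer u"
  by (simp add: fejer_def)

lemma integrable_hat: "integrable lborel hat"
  by (rule Bochner_Integration.integrable_bound[of _ "indicator {-1..1} :: real \<Rightarrow> real"])
     (use hat_bounds in \<open>auto intro!: AE_I2\<close>)

lemma fejer_le: "fejer u \<le> 8 * inverse (1 + u\<^sup>2)"
proof (cases "u = 0")
  case False
  have "1 - cos u = 2 * (sin (u / 2))\<^sup>2"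
    using cos_double_sin[of "u / 2"] by simp
  moreover have "(sin (u / 2))\<^sup>2 \<le> (u / 2)\<^sup>2"
    using abs_sin_x_le_abs_x[of "u / 2"] by (simp only: abs_le_square_iff)
  ultimately have "2 * (1 - cos u) \<le> u\<^sup>2" by (simp add: power_divide)
  have "2 * (1 - cos u) \<le> 4"
  proof -
    define c where "c = cos u"
    have "c \<ge> - 1" by (simp add: c_def)
    then show ?thesis unfolding c_def[symmetric] by (simp add: algebra_simps)
  qed
  \<comment> \<open>Here a stands for the numerator of the kernel and v for u^2: the bound v handles
    the origin and the bound 4 handles infinity. Together they give 5 v, rounded up to 8 v.\<close>
  have *: "a * (1 + v) \<le> 8 * v" if "a \<le> v" "a \<le> 4" "0 \<le> v" for a v :: real
    using mult_right_mono[OF that(2,3)] that by (simp add: distrib_left)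
  have "2 * (1 - cos u) * (1 + u\<^sup>2) \<le> 8 * u\<^sup>2"
    using \<open>2 * (1 - cos u) \<le> u\<^sup>2\<close> \<open>2 * (1 - cos u) \<le> 4\<close> by (intro *) auto
  moreover have "u\<^sup>2 > 0" "1 + u\<^sup>2 > 0" using False by (auto intro: add_pos_nonneg)
  ultimately show ?thesis
    by (simp only: fejer_def divide_inverse[symmetric] pos_le_divide_eq pos_divide_le_eq times_divide_eq_left)
qed (simp add: fejer_def)

lemma integrable_fejer: "integrable lborel fejer"
proof (rule Bochner_Integration.integrable_bound)
  show "integrable lborel (\<lambda>u::real. 8 * inverse (1 + u\<^sup>2))"
    using integrable_inverse_1_plus_square by (simp add: set_integrable_def)
  show "AE u in lborel. norm (fejer u) \<le> norm (8 * inverse (1 + u\<^sup>2))"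
    using fejer_le fejer_nonneg by (auto intro!: AE_I2 simp: abs_of_nonneg)
qed simp

text \<open>The Tauberian argument divides by the total mass of the kernel. Positivity is read off
  on [1, 2], where cos u <= cos 1 and u^2 <= 4.\<close>

lemma integral_fejer_pos: "integral\<^sup>L lborel fejer > 0"
proof -
  define c :: real where "c = 2 * (1 - cos 1) / 2\<^sup>2"
  have "cos (1::real) < 1" using cos_monotone_0_pi[of 0 1] pi_gt3 by simp
  then have "c > 0" by (simp add: c_def)
  have "integral\<^sup>L lborel (\<lambda>u. c * indicator {1..2::real} u) \<le> integral\<^sup>L lborel fejer"
  proof (rule integral_mono)
    fix u :: real
    show "c * indicator {1..2::real} u \<le> fejer u"
    proof (cases "u \<in> {1..2}")
      case True
      then have "cos u \<le> cos 1" using pi_gt3 by (intro cos_monotone_0_pi_le) auto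
      moreover have "u\<^sup>2 \<le> 2\<^sup>2" using True by (intro power_mono) auto
      ultimately have "c \<le> fejer u"
        unfolding c_def fejer_def using True by (intro frac_le) auto
      then show ?thesis using True by simp
    qed (simp add: fejer_nonneg)
  qed (auto intro: integrable_fejer)
  then show ?thesis using \<open>c > 0\<close> by simp
qed

lemma has_integral_affine_exp:
  fixes w a b :: complex and l u :: real
  assumes "w \<noteq> 0" "l \<le> u"
  defines "F \<equiv> \<lambda>z. (a + b * z) * exp (w * z) / w - b * exp (w * z) / w\<^sup>2"
  shows "((\<lambda>x. (a + b * of_real x) * exp (w * of_real x)) has_integral (F (of_real u) - F (of_real l))) {l..u}"
proof (rule fundamental_theorem_of_calculus[OF assms(2)])
  fix x :: real
  have "(F has_field_derivative (a + b * of_real x) * exp (w * of_real x)) (at (of_real x))"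
    unfolding F_def using assms(1) by (auto intro!: derivative_eq_intros simp: field_simps power2_eq_square)
  then show "((\<lambda>x. F (of_real x)) has_vector_derivative (a + b * of_real x) * exp (w * of_real x)) (at x within {l..u})"
    by (intro has_vector_derivative_real_field) (rule has_field_derivative_subset, auto)
qed

lemma integrable_hat_cis: "integrable lborel (\<lambda>\<xi>. hat \<xi> *\<^sub>R cis (u * \<xi>))"
  by (rule Bochner_Integration.integrable_bound[OF integrable_hat]) (auto simp: hat_bounds)

text \<open>Each edge of the triangle is integrated separately as an affine function times an
  exponential. The point u = 0 is excluded because the integral equals 1 there, whereas
  \<open>fejer 0\<close> is 0.\<close>

lemma fejer_hat_transform:
  assumes "u \<noteq> 0"
  shows "(\<integral>\<xi>. hat \<xi> *\<^sub>R cis (u * \<xi>) \<partial>lborel) = of_real (fejer u)"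
proof -
  define f where "f = (\<lambda>\<xi>. hat \<xi> *\<^sub>R cis (u * \<xi>))"
  define w where "w = \<i> * complex_of_real u"
  have w: "w \<noteq> 0" using assms by (simp add: w_def)
  have cis: "cis (u * \<xi>) = exp (w * of_real \<xi>)" for \<xi>
    by (simp add: cis_conv_exp w_def mult.assoc)
  have "(f has_integral (1 / w - 1 / w\<^sup>2 + exp (- w) / w\<^sup>2)) {-1..0}" (is "(_ has_integral ?I) _")
  proof (rule has_integral_eq)
    show "((\<lambda>x. (1 + 1 * of_real x) * exp (w * of_real x)) has_integral ?I) {-1..0}"
      using has_integral_affine_exp[OF w, of "-1" 0 1 1] by (simp add: algebra_simps)
  qed (auto simp: f_def cis hat_def scaleR_conv_of_real)
  moreover have "(f has_integral (exp w / w\<^sup>2 - 1 / w - 1 / w\<^sup>2)) {0..1}" (is "(_ has_integral ?I) _")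
  proof (rule has_integral_eq)
    show "((\<lambda>x. (1 + - 1 * of_real x) * exp (w * of_real x)) has_integral ?I) {0..1}"
      using has_integral_affine_exp[OF w, of 0 1 1 "-1"] by (simp add: algebra_simps)
  qed (auto simp: f_def cis hat_def scaleR_conv_of_real)
  ultimately have "(f has_integral (1 / w - 1 / w\<^sup>2 + exp (- w) / w\<^sup>2 + (exp w / w\<^sup>2 - 1 / w - 1 / w\<^sup>2))) {-1..1}"
    by (intro has_integral_combine[of "-1" 0 1]) auto
  moreover have "1 / w - 1 / w\<^sup>2 + exp (- w) / w\<^sup>2 + (exp w / w\<^sup>2 - 1 / w - 1 / w\<^sup>2) = of_real (fejer u)"
  proof -
    have "exp w + exp (- w) = of_real (2 * cos u)"
    proof -
      have "exp w = cis u" "exp (- w) = cis (- u)" by (simp_all add: w_def cis_conv_exp)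
      then show ?thesis by (simp add: complex_eq_iff)
    qed
    moreover have "w\<^sup>2 = - of_real (u\<^sup>2)" by (simp add: w_def power_mult_distrib)
    moreover have "1 / w - 1 / w\<^sup>2 + exp (- w) / w\<^sup>2 + (exp w / w\<^sup>2 - 1 / w - 1 / w\<^sup>2)
        = (exp w + exp (- w) - 2) / w\<^sup>2"
      by (simp add: add_divide_distrib diff_divide_distrib)
    ultimately show ?thesis
      using assms by (simp add: fejer_def divide_simps)
  qed
  ultimately have "(f has_integral of_real (fejer u)) {-1..1}" by simp
  then have "(f has_integral of_real (fejer u)) UNIV"
    by (rule has_integral_on_superset) (auto simp: f_def hat_def)
  moreover have "(f has_integral (\<integral>\<xi>. f \<xi> \<partial>lborel)) UNIV"
    using integrable_hat_cis[of u] unfolding f_def by (rule has_integral_integral_lborel)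
  ultimately show ?thesis unfolding f_def by (rule has_integral_unique[symmetric])
qed

text \<open>Translating by pi / T reverses the sign of cis(T x). Hence twice the integral equals
  that of the difference of \<psi> and its translate against cis(T x), and continuity makes this
  difference small.\<close>

lemma riemann_lebesgue:
  fixes \<psi> :: "real \<Rightarrow> complex"
  assumes cont: "continuous_on UNIV \<psi>" and supp: "\<And>x. \<bar>x\<bar> > 1 \<Longrightarrow> \<psi> x = 0"
  shows "((\<lambda>T. \<integral>x. \<psi> x * cis (T * x) \<partial>lborel) \<longlongrightarrow> 0) at_top"
proof -
  obtain M where M: "norm (\<psi> x) \<le> M" for x
  proof -
    have "compact (\<psi> ` {-1..1})"
      using cont by (intro compact_continuous_image) (auto intro: continuous_on_subset)
    then obtain B where "\<forall>z\<in>\<psi> ` {-1..1}. norm z \<le> B" using compact_imp_bounded bounded_iff by blast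
    then have "norm (\<psi> x) \<le> max B 0" for x
      using supp[of x] by (cases "x \<in> {-1..1}") (auto simp: le_max_iff_disj abs_if)
    then show ?thesis using that by blast
  qed
  have [measurable]: "\<psi> \<in> borel_measurable borel"
    using cont by (rule borel_measurable_continuous_onI)
  have int: "integrable lborel \<psi>"
  proof (rule Bochner_Integration.integrable_bound)
    show "integrable lborel (\<lambda>x. M * indicator {-1..1::real} x)" by simp
    show "AE x in lborel. norm (\<psi> x) \<le> norm (M * indicator {-1..1} x)"
      using M supp by (intro AE_I2) (force simp: indicator_def intro: order_trans[OF M])
  qed simp
  have int_cis: "integrable lborel (\<lambda>x. f x * cis (T * x))" if "integrable lborel f" for f T
    by (rule Bochner_Integration.integrable_bound[OF that]) (use that in \<open>auto simp: norm_mult\<close>)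
  have lim: "((\<lambda>T. \<integral>x. norm (\<psi> x - \<psi> (x + pi / T)) \<partial>lborel) \<longlongrightarrow> (\<integral>x. 0 \<partial>(lborel::real measure))) at_top"
  proof (rule integral_dominated_convergence_at_top[where w = "\<lambda>x. 2 * M * indicator {-2..2} x"])
    have "((\<lambda>T. norm (\<psi> x - \<psi> (x + pi / T))) \<longlongrightarrow> 0) at_top" for x
    proof -
      have "((\<lambda>T::real. x + pi / T) \<longlongrightarrow> x + 0) at_top"
        by (intro tendsto_add tendsto_const real_tendsto_divide_at_top[OF tendsto_const] filterlim_ident)
      moreover have "isCont \<psi> (x + 0)" using cont by (simp add: continuous_on_eq_continuous_at)
      ultimately have "((\<lambda>T. \<psi> (x + pi / T)) \<longlongrightarrow> \<psi> (x + 0)) at_top"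
        by (intro isCont_tendsto_compose[where g = \<psi>])
      then have "((\<lambda>T. norm (\<psi> x - \<psi> (x + pi / T))) \<longlongrightarrow> norm (\<psi> x - \<psi> (x + 0))) at_top"
        by (intro tendsto_intros)
      then show ?thesis by simp
    qed
    then show "AE x in lborel. ((\<lambda>T. norm (\<psi> x - \<psi> (x + pi / T))) \<longlongrightarrow> 0) at_top" by simp
    \<comment> \<open>For T >= pi the shift is at most 1, so the difference vanishes outside [-2, 2]
      and has an integrable majorant.\<close>
    show "\<forall>\<^sub>F T in at_top. AE x in lborel. norm (norm (\<psi> x - \<psi> (x + pi / T))) \<le> 2 * M * indicator {-2..2} x"
    proof (rule eventually_mono[OF eventually_ge_at_top[of pi]], rule AE_I2)
      fix T x :: real assume T: "T \<ge> pi"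
      then have "T > 0" using pi_gt_zero by linarith
      then have "0 \<le> pi / T" "pi / T \<le> 1" using T by auto
      then have "norm (\<psi> x - \<psi> (x + pi / T)) = 0" if "\<bar>x\<bar> > 2" using supp[of x] supp[of "x + pi / T"] that by auto
      moreover have "norm (\<psi> x - \<psi> (x + pi / T)) \<le> 2 * M"
        using norm_triangle_ineq4[of "\<psi> x" "\<psi> (x + pi / T)"] M[of x] M[of "x + pi / T"] by linarith
      ultimately show "norm (norm (\<psi> x - \<psi> (x + pi / T))) \<le> 2 * M * indicator {-2..2} x"
        by (cases "\<bar>x\<bar> > 2") (auto simp: indicator_def)
    qed
  qed auto
  have le: "norm (\<integral>x. \<psi> x * cis (T * x) \<partial>lborel) \<le> (\<integral>x. norm (\<psi> x - \<psi> (x + pi / T)) \<partial>lborel)" if "T > 0" for T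
  proof -
    have int': "integrable lborel (\<lambda>x. \<psi> (x + pi / T))"
      using lborel_integrable_real_affine[OF int, of 1 "pi / T"] by (simp add: add.commute)
    have "(\<integral>x. \<psi> x * cis (T * x) \<partial>lborel) = (\<integral>x. \<psi> (x + pi / T) * cis (T * (x + pi / T)) \<partial>lborel)"
      using lborel_integral_real_affine[of 1 "\<lambda>x. \<psi> x * cis (T * x)" "pi / T"] by (simp add: add.commute)
    also have "\<dots> = (\<integral>x. - (\<psi> (x + pi / T) * cis (T * x)) \<partial>lborel)"
    proof -
      have "cis (T * (x + pi / T)) = - cis (T * x)" for x
        using that by (simp add: distrib_left flip: cis_mult)
      then show ?thesis by simp
    qed
    finally have "2 * (\<integral>x. \<psi> x * cis (T * x) \<partial>lborel) =
        (\<integral>x. \<psi> x * cis (T * x) \<partial>lborel) + (\<integral>x. - (\<psi> (x + pi / T) * cis (T * x)) \<partial>lborel)"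
      by simp
    also have "\<dots> = (\<integral>x. \<psi> x * cis (T * x) + - (\<psi> (x + pi / T) * cis (T * x)) \<partial>lborel)"
      using int_cis[OF int] int_cis[OF int'] by (intro Bochner_Integration.integral_add[symmetric]) auto
    also have "\<dots> = (\<integral>x. (\<psi> x - \<psi> (x + pi / T)) * cis (T * x) \<partial>lborel)"
      by (simp add: algebra_simps)
    finally have eq: "2 * (\<integral>x. \<psi> x * cis (T * x) \<partial>lborel) = \<dots>" .
    have "norm (\<integral>x. \<psi> x * cis (T * x) \<partial>lborel) \<le> norm (2 * (\<integral>x. \<psi> x * cis (T * x) \<partial>lborel))"
      by (simp add: norm_mult)
    also have "\<dots> \<le> (\<integral>x. norm ((\<psi> x - \<psi> (x + pi / T)) * cis (T * x)) \<partial>lborel)"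
      unfolding eq by (rule integral_norm_bound)
    also have "\<dots> = (\<integral>x. norm (\<psi> x - \<psi> (x + pi / T)) \<partial>lborel)" by (simp add: norm_mult)
    finally show ?thesis .
  qed
  have "\<forall>\<^sub>F T in at_top. norm (\<integral>x. \<psi> x * cis (T * x) \<partial>lborel) \<le> (\<integral>x. norm (\<psi> x - \<psi> (x + pi / T)) \<partial>lborel)"
    by (rule eventually_mono[OF eventually_gt_at_top[of 0]]) (rule le)
  from Lim_null_comparison[OF this] lim show ?thesis by simp
qed

text \<open>The kernel is replaced by the Fourier integral of the triangle and the order of
  integration is exchanged; the inner integral over t is then the Laplace transform at \<epsilon> +
  i \<xi>. The damping factor exp(-\<epsilon> t) provides the absolute integrability that Fubini
  requires.\<close>

lemma fejer_convolution_eq: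
  fixes h :: "real \<Rightarrow> real" and g :: "complex \<Rightarrow> complex" and \<epsilon> T :: real
  assumes h [measurable]: "h \<in> borel_measurable borel"
    and lap: "\<And>s. Re s = \<epsilon> \<Longrightarrow> has_bochner_integral lborel (\<lambda>t. h t *\<^sub>R exp (- s * of_real t)) (g s)"
  shows "(\<integral>t. of_real (h t * exp (- \<epsilon> * t) * fejer (T - t)) \<partial>lborel)
       = (\<integral>\<xi>. hat \<xi> *\<^sub>R (g (Complex \<epsilon> \<xi>) * cis (T * \<xi>)) \<partial>lborel)"
proof -
  define k where "k = (\<lambda>t. h t * exp (- \<epsilon> * t))"
  have [measurable]: "k \<in> borel_measurable borel" unfolding k_def by measurable
  have exp_eq: "h t *\<^sub>R exp (- Complex \<epsilon> \<xi> * of_real t) = k t *\<^sub>R cis (- \<xi> * t)" for t \<xi>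
  proof -
    have "- Complex \<epsilon> \<xi> * of_real t = of_real (- \<epsilon> * t) + \<i> * of_real (- \<xi> * t)"
      by (simp add: complex_eq_iff)
    then have "exp (- Complex \<epsilon> \<xi> * of_real t) = of_real (exp (- \<epsilon> * t)) * cis (- \<xi> * t)"
      by (simp only: exp_add exp_of_real cis_conv_exp)
    then show ?thesis by (simp add: k_def scaleR_conv_of_real)
  qed
  have k_int: "integrable lborel k"
  proof -
    have "integrable lborel (\<lambda>t. k t *\<^sub>R cis (- 0 * t))"
      using lap[of "Complex \<epsilon> 0"] unfolding exp_eq by (auto simp: has_bochner_integral_iff)
    from integrable_Re[OF this] show ?thesis by simp
  qed
  define F :: "real \<Rightarrow> real \<Rightarrow> complex"
    where "F = (\<lambda>\<xi> t. (hat \<xi> * k t) *\<^sub>R cis ((T - t) * \<xi>))"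
  have F_int: "integrable (lborel \<Otimes>\<^sub>M lborel) (case_prod F)"
  proof (rule lborel_pair.Fubini_integrable)
    show "case_prod F \<in> borel_measurable (lborel \<Otimes>\<^sub>M lborel)"
      unfolding F_def by measurable
    have "(\<integral>t. norm (F \<xi> t) \<partial>lborel) = hat \<xi> * (\<integral>t. \<bar>k t\<bar> \<partial>lborel)" for \<xi>
      by (simp add: F_def abs_mult hat_bounds)
    then show "integrable lborel (\<lambda>\<xi>. \<integral>t. norm (case_prod F (\<xi>, t)) \<partial>lborel)"
      using integrable_hat by simp
    show "AE \<xi> in lborel. integrable lborel (\<lambda>t. case_prod F (\<xi>, t))"
    proof (rule AE_I2)
      fix \<xi> :: real
      show "integrable lborel (\<lambda>t. case_prod F (\<xi>, t))"
        by (rule Bochner_Integration.integrable_bound[OF integrable_mult_right[OF k_int, of "hat \<xi>"]])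
           (auto simp: F_def)
    qed
  qed
  have "(\<integral>t. of_real (k t * fejer (T - t)) \<partial>lborel) = (\<integral>t. (\<integral>\<xi>. F \<xi> t \<partial>lborel) \<partial>lborel)"
  proof (rule integral_cong_AE)
    show "AE t in lborel. complex_of_real (k t * fejer (T - t)) = (\<integral>\<xi>. F \<xi> t \<partial>lborel)"
      \<comment> \<open>The transform formula is available except at t = T, where the argument of
        the kernel is 0.\<close>
      using AE_lborel_singleton[of T]
    proof eventually_elim
      fix t :: real assume "t \<noteq> T"
      then have "complex_of_real (fejer (T - t)) = (\<integral>\<xi>. hat \<xi> *\<^sub>R cis ((T - t) * \<xi>) \<partial>lborel)"
        by (subst fejer_hat_transform) auto
      then have "complex_of_real (k t * fejer (T - t)) = k t *\<^sub>R (\<integral>\<xi>. hat \<xi> *\<^sub>R cis ((T - t) * \<xi>) \<partial>lborel)"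
        by (simp add: scaleR_conv_of_real)
      also have "\<dots> = (\<integral>\<xi>. k t *\<^sub>R hat \<xi> *\<^sub>R cis ((T - t) * \<xi>) \<partial>lborel)"
        by (rule integral_scaleR_right[symmetric])
      also have "\<dots> = (\<integral>\<xi>. F \<xi> t \<partial>lborel)" by (simp add: F_def mult.commute)
      finally show "complex_of_real (k t * fejer (T - t)) = (\<integral>\<xi>. F \<xi> t \<partial>lborel)" .
    qed
    show "(\<lambda>t. complex_of_real (k t * fejer (T - t))) \<in> borel_measurable lborel" by measurable
    show "(\<lambda>t. \<integral>\<xi>. F \<xi> t \<partial>lborel) \<in> borel_measurable lborel"
      unfolding F_def by measurable
  qed
  also have "\<dots> = (\<integral>\<xi>. (\<integral>t. F \<xi> t \<partial>lborel) \<partial>lborel)"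
    by (rule lborel_pair.Fubini_integral[OF F_int])
  also have "\<dots> = (\<integral>\<xi>. hat \<xi> *\<^sub>R (g (Complex \<epsilon> \<xi>) * cis (T * \<xi>)) \<partial>lborel)"
  proof (rule Bochner_Integration.integral_cong)
    fix \<xi> :: real
    have "(\<integral>t. F \<xi> t \<partial>lborel) = (\<integral>t. hat \<xi> *\<^sub>R ((k t *\<^sub>R cis (- \<xi> * t)) * cis (T * \<xi>)) \<partial>lborel)"
      by (intro Bochner_Integration.integral_cong) (auto simp: F_def cis_mult algebra_simps)
    also have "\<dots> = hat \<xi> *\<^sub>R ((\<integral>t. k t *\<^sub>R cis (- \<xi> * t) \<partial>lborel) * cis (T * \<xi>))"
      by (simp only: integral_scaleR_right integral_mult_left_zero)
    also have "(\<integral>t. k t *\<^sub>R cis (- \<xi> * t) \<partial>lborel) = g (Complex \<epsilon> \<xi>)"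
      using lap[of "Complex \<epsilon> \<xi>"] unfolding exp_eq by (simp add: has_bochner_integral_iff)
    finally show "(\<integral>t. F \<xi> t \<partial>lborel) = hat \<xi> *\<^sub>R (g (Complex \<epsilon> \<xi>) * cis (T * \<xi>))" .
  qed auto
  finally show ?thesis by (simp add: k_def mult.assoc)
qed

text \<open>Dominated convergence as the damping goes to 0. On the left the kernel dominates, since
  h is bounded and lives on t >= 0, where exp(-\<epsilon> t) <= 1. On the right the triangle sees g
  only on the compact box [0, 1] x [-1, 1], where continuity bounds it.\<close>

lemma fejer_convolution_boundary:
  fixes h :: "real \<Rightarrow> real" and g :: "complex \<Rightarrow> complex" and T :: real
  assumes h [measurable]: "h \<in> borel_measurable borel"
    and bound: "\<And>t. \<bar>h t\<bar> \<le> 1" and neg: "\<And>t. t < 0 \<Longrightarrow> h t = 0"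
    and lap: "\<And>s. Re s > 0 \<Longrightarrow> has_bochner_integral lborel (\<lambda>t. h t *\<^sub>R exp (- s * of_real t)) (g s)"
    and cont: "continuous_on {s. Re s \<ge> 0} g"
  shows "(\<integral>t. of_real (h t * fejer (T - t)) \<partial>lborel)
       = (\<integral>\<xi>. hat \<xi> *\<^sub>R (g (Complex 0 \<xi>) * cis (T * \<xi>)) \<partial>lborel)"
proof -
  define \<epsilon> where "\<epsilon> n = 1 / real (Suc n)" for n
  have \<epsilon>: "0 < \<epsilon> n" "\<epsilon> n \<le> 1" for n by (auto simp: \<epsilon>_def)
  have \<epsilon>_lim: "\<epsilon> \<longlonglongrightarrow> 0" unfolding \<epsilon>_def by real_asymp
  define K where "K = cbox (Complex 0 (-1)) (Complex 1 1)"
  have "compact (g ` K)"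
    using cont by (intro compact_continuous_image) (auto simp: K_def in_cbox_complex_iff intro: continuous_on_subset)
  then obtain B where B: "\<And>z. z \<in> K \<Longrightarrow> norm (g z) \<le> B"
    using compact_imp_bounded bounded_iff by (metis image_eqI)
  have cont': "continuous_on UNIV (\<lambda>\<xi>. g (Complex e \<xi>))" if "e \<ge> 0" for e
    by (rule continuous_on_compose2[OF cont]) (use that in \<open>auto intro!: continuous_intros simp: Complex_eq\<close>)
  have meas [measurable]: "(\<lambda>\<xi>. g (Complex e \<xi>)) \<in> borel_measurable borel" if "e \<ge> 0" for e
    using cont'[OF that] by (rule borel_measurable_continuous_onI)
  have int: "integrable lborel (\<lambda>t. fejer (T - t))"
    using lborel_integrable_real_affine[OF integrable_fejer, of "-1" T] by simp
  have "(\<lambda>n. \<integral>t. complex_of_real (h t * exp (- \<epsilon> n * t) * fejer (T - t)) \<partial>lborel)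
      \<longlonglongrightarrow> (\<integral>t. of_real (h t * fejer (T - t)) \<partial>lborel)"
  proof (rule integral_dominated_convergence[OF _ _ int])
    show "AE t in lborel. (\<lambda>n. complex_of_real (h t * exp (- \<epsilon> n * t) * fejer (T - t))) \<longlonglongrightarrow> of_real (h t * fejer (T - t))"
    proof (rule AE_I2)
      fix t
      have "(\<lambda>n. complex_of_real (h t * exp (- \<epsilon> n * t) * fejer (T - t))) \<longlonglongrightarrow> of_real (h t * exp (- 0 * t) * fejer (T - t))"
        by (intro tendsto_intros \<epsilon>_lim)
      then show "(\<lambda>n. complex_of_real (h t * exp (- \<epsilon> n * t) * fejer (T - t))) \<longlonglongrightarrow> of_real (h t * fejer (T - t))"
        by simp
    qed
    show "AE t in lborel. norm (complex_of_real (h t * exp (- \<epsilon> n * t) * fejer (T - t))) \<le> fejer (T - t)" for n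
    proof (rule AE_I2)
      fix t
      have "\<bar>h t * exp (- \<epsilon> n * t)\<bar> \<le> 1"
      proof (cases "t < 0")
        case False
        then have "exp (- \<epsilon> n * t) \<le> 1" using \<epsilon>[of n] by simp
        then show ?thesis using bound[of t] by (simp add: abs_mult mult_le_one)
      qed (simp add: neg)
      then show "norm (complex_of_real (h t * exp (- \<epsilon> n * t) * fejer (T - t))) \<le> fejer (T - t)"
        using fejer_nonneg[of "T - t"]
        by (simp only: norm_of_real abs_mult[of "h t * exp (- \<epsilon> n * t)"] abs_of_nonneg mult_left_le_one_le abs_ge_zero)
    qed
  qed auto
  moreover have "(\<lambda>n. \<integral>\<xi>. hat \<xi> *\<^sub>R (g (Complex (\<epsilon> n) \<xi>) * cis (T * \<xi>)) \<partial>lborel)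
      \<longlonglongrightarrow> (\<integral>\<xi>. hat \<xi> *\<^sub>R (g (Complex 0 \<xi>) * cis (T * \<xi>)) \<partial>lborel)"
  proof (rule integral_dominated_convergence[OF _ _ integrable_mult_right[OF integrable_hat, of B]])
    show "(\<lambda>\<xi>. hat \<xi> *\<^sub>R (g (Complex 0 \<xi>) * cis (T * \<xi>))) \<in> borel_measurable lborel"
      using meas[of 0] by simp
    show "(\<lambda>\<xi>. hat \<xi> *\<^sub>R (g (Complex (\<epsilon> n) \<xi>) * cis (T * \<xi>))) \<in> borel_measurable lborel" for n
      using meas[of "\<epsilon> n"] \<epsilon>[of n] by simp
    show "AE \<xi> in lborel. (\<lambda>n. hat \<xi> *\<^sub>R (g (Complex (\<epsilon> n) \<xi>) * cis (T * \<xi>))) \<longlonglongrightarrow> hat \<xi> *\<^sub>R (g (Complex 0 \<xi>) * cis (T * \<xi>))"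
    proof (rule AE_I2)
      fix \<xi> :: real
      have "(\<lambda>n. Complex (\<epsilon> n) \<xi>) \<longlonglongrightarrow> Complex 0 \<xi>"
        by (intro tendsto_intros \<epsilon>_lim)
      then have "(\<lambda>n. g (Complex (\<epsilon> n) \<xi>)) \<longlonglongrightarrow> g (Complex 0 \<xi>)"
        by (rule continuous_on_tendsto_compose[OF cont]) (use \<epsilon> in \<open>auto simp: less_imp_le\<close>)
      then show "(\<lambda>n. hat \<xi> *\<^sub>R (g (Complex (\<epsilon> n) \<xi>) * cis (T * \<xi>))) \<longlonglongrightarrow> hat \<xi> *\<^sub>R (g (Complex 0 \<xi>) * cis (T * \<xi>))"
        by (intro tendsto_intros)
    qed
    show "AE \<xi> in lborel. norm (hat \<xi> *\<^sub>R (g (Complex (\<epsilon> n) \<xi>) * cis (T * \<xi>))) \<le> B * hat \<xi>" for n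
    proof (rule AE_I2)
      fix \<xi> :: real
      show "norm (hat \<xi> *\<^sub>R (g (Complex (\<epsilon> n) \<xi>) * cis (T * \<xi>))) \<le> B * hat \<xi>"
      proof (cases "\<bar>\<xi>\<bar> \<le> 1")
        case True
        then have "norm (g (Complex (\<epsilon> n) \<xi>)) \<le> B"
          using \<epsilon>[of n] by (intro B) (auto simp: K_def in_cbox_complex_iff)
        then show ?thesis using hat_bounds(1)[of \<xi>] by (simp add: norm_mult mult.commute[of B] mult_left_mono)
      next
        case False
        then have "hat \<xi> = 0" by (simp add: hat_def)
        then show ?thesis by simp
      qed
    qed
  qed
  moreover have "(\<integral>t. complex_of_real (h t * exp (- \<epsilon> n * t) * fejer (T - t)) \<partial>lborel) =
      (\<integral>\<xi>. hat \<xi> *\<^sub>R (g (Complex (\<epsilon> n) \<xi>) * cis (T * \<xi>)) \<partial>lborel)" for n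
    using \<epsilon>[of n] by (intro fejer_convolution_eq h lap) auto
  ultimately show ?thesis using LIMSEQ_unique by simp
qed

lemma fejer_convolution_tendsto_0:
  fixes h :: "real \<Rightarrow> real" and g :: "complex \<Rightarrow> complex"
  assumes h [measurable]: "h \<in> borel_measurable borel"
    and bound: "\<And>t. \<bar>h t\<bar> \<le> 1" and neg: "\<And>t. t < 0 \<Longrightarrow> h t = 0"
    and lap: "\<And>s. Re s > 0 \<Longrightarrow> has_bochner_integral lborel (\<lambda>t. h t *\<^sub>R exp (- s * of_real t)) (g s)"
    and cont: "continuous_on {s. Re s \<ge> 0} g"
  shows "((\<lambda>T. \<integral>v. h (T - v) * fejer v \<partial>lborel) \<longlongrightarrow> 0) at_top"
proof -
  have "((\<lambda>T. \<integral>\<xi>. hat \<xi> *\<^sub>R g (Complex 0 \<xi>) * cis (T * \<xi>) \<partial>lborel) \<longlongrightarrow> 0) at_top"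
  proof (rule riemann_lebesgue)
    show "continuous_on UNIV (\<lambda>\<xi>. hat \<xi> *\<^sub>R g (Complex 0 \<xi>))"
      by (intro continuous_intros continuous_on_compose2[OF cont]) (auto intro!: continuous_intros simp: Complex_eq)
  qed (auto simp: hat_def)
  moreover have "(\<integral>\<xi>. hat \<xi> *\<^sub>R g (Complex 0 \<xi>) * cis (T * \<xi>) \<partial>lborel) =
      of_real (\<integral>v. h (T - v) * fejer v \<partial>lborel)" for T
  proof -
    have "(\<integral>\<xi>. hat \<xi> *\<^sub>R g (Complex 0 \<xi>) * cis (T * \<xi>) \<partial>lborel) = of_real (\<integral>t. h t * fejer (T - t) \<partial>lborel)"
      using fejer_convolution_boundary[OF assms, of T] by (simp del: of_real_mult)
    also have "(\<integral>t. h t * fejer (T - t) \<partial>lborel) = (\<integral>v. h (T - v) * fejer v \<partial>lborel)"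
      using lborel_integral_real_affine[of "-1" "\<lambda>t. h t * fejer (T - t)" T] by simp
    finally show ?thesis .
  qed
  ultimately show ?thesis by (simp add: tendsto_of_real_iff[of _ 0, where 'a = complex, simplified])
qed

section \<open>Recovering a slowly oscillating function from its Fejer averages\<close>

lemma fejer_tail: "((\<lambda>R. \<integral>v. fejer v * indicator {v. \<bar>v\<bar> > R} v \<partial>lborel) \<longlongrightarrow> 0) at_top"
proof -
  have "((\<lambda>R. \<integral>v. fejer v * indicator {v. \<bar>v\<bar> > R} v \<partial>lborel) \<longlongrightarrow> (\<integral>v. 0 \<partial>(lborel::real measure))) at_top"
  proof (rule integral_dominated_convergence_at_top[OF _ _ integrable_fejer])
    show "AE v in lborel. ((\<lambda>R. fejer v * indicator {v. \<bar>v\<bar> > R} v) \<longlongrightarrow> 0) at_top"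
    proof (rule AE_I2, rule tendsto_eventually)
      fix v :: real
      show "\<forall>\<^sub>F R in at_top. fejer v * indicator {v. \<bar>v\<bar> > R} v = 0"
        using eventually_ge_at_top[of "\<bar>v\<bar>"] by eventually_elim auto
    qed
    show "\<forall>\<^sub>F R in at_top. AE v in lborel. norm (fejer v * indicator {v. \<bar>v\<bar> > R} v) \<le> fejer v"
      using fejer_nonneg by (auto simp: indicator_def)
  qed auto
  then show ?thesis by simp
qed

lemma slowly_oscillating_tendsto_0:
  fixes h :: "real \<Rightarrow> real"
  assumes h [measurable]: "h \<in> borel_measurable borel"
    and bound: "\<And>t. \<bar>h t\<bar> \<le> 1"
    and slow: "\<And>\<delta>. \<delta> > 0 \<Longrightarrow> \<exists>\<eta>>0. \<forall>\<^sub>F T in at_top. \<forall>w. \<bar>w\<bar> \<le> \<eta> \<longrightarrow> \<bar>h T - h (T - w)\<bar> \<le> \<delta>"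
    and conv: "\<And>r. r > 0 \<Longrightarrow> ((\<lambda>T. \<integral>v. h (T - v / r) * fejer v \<partial>lborel) \<longlongrightarrow> 0) at_top"
  shows "(h \<longlongrightarrow> 0) at_top"
proof (rule tendstoI)
  fix e :: real assume e: "e > 0"
  define C where "C = integral\<^sup>L lborel fejer"
  have C: "C > 0" unfolding C_def by (rule integral_fejer_pos)
  from slow[of "e / 3"] e obtain \<eta> where \<eta>: "\<eta> > 0"
    and slow': "\<forall>\<^sub>F T in at_top. \<forall>w. \<bar>w\<bar> \<le> \<eta> \<longrightarrow> \<bar>h T - h (T - w)\<bar> \<le> e / 3" by auto
  \<comment> \<open>The error is budgeted against e C: one third for the oscillation of h within |v|
    <= R, one third for the tail (the kernel mass there is below e C / 6 and |h T - h(T - v/r)| <=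
    2), and one third for the average itself.\<close>
  have "\<forall>\<^sub>F R in at_top. \<bar>\<integral>v. fejer v * indicator {v. \<bar>v\<bar> > R} v \<partial>lborel\<bar> < e * C / 6"
    using tendstoD[OF fejer_tail, of "e * C / 6"] e C by simp
  then have "\<forall>\<^sub>F R in at_top. R > 0 \<and> \<bar>\<integral>v. fejer v * indicator {v. \<bar>v\<bar> > R} v \<partial>lborel\<bar> < e * C / 6"
    using eventually_gt_at_top[of 0] by eventually_elim auto
  then obtain R where R: "R > 0" "\<bar>\<integral>v. fejer v * indicator {v. \<bar>v\<bar> > R} v \<partial>lborel\<bar> < e * C / 6"
    using eventually_happens'[OF trivial_limit_at_top_linorder] by blast
  \<comment> \<open>With this scale, |v| <= R corresponds exactly to shifts |v / r| <= \<eta>, for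
    which h hardly changes.\<close>
  define r where "r = R / \<eta>"
  have r: "r > 0" using R \<eta> by (simp add: r_def)
  have "\<forall>\<^sub>F T in at_top. \<bar>\<integral>v. h (T - v / r) * fejer v \<partial>lborel\<bar> < e * C / 3"
    using tendstoD[OF conv[OF r], of "e * C / 3"] e C by simp
  then show "\<forall>\<^sub>F T in at_top. dist (h T) 0 < e"
    using slow'
  proof eventually_elim
    fix T
    assume 1: "\<bar>\<integral>v. h (T - v / r) * fejer v \<partial>lborel\<bar> < e * C / 3"
      and 2: "\<forall>w. \<bar>w\<bar> \<le> \<eta> \<longrightarrow> \<bar>h T - h (T - w)\<bar> \<le> e / 3"
    have int: "integrable lborel (\<lambda>v. f v * fejer v)"
      if [measurable]: "f \<in> borel_measurable borel" and "\<And>v. \<bar>f v\<bar> \<le> 1" for f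
      by (rule Bochner_Integration.integrable_bound[OF integrable_fejer])
         (use that fejer_nonneg in \<open>auto intro!: AE_I2 mult_left_le_one_le simp: abs_mult\<close>)
    have int1: "integrable lborel (\<lambda>v. h T * fejer v)" "integrable lborel (\<lambda>v. h (T - v / r) * fejer v)"
      by (intro int bound; measurable)+
    have tail_int: "integrable lborel (\<lambda>v. fejer v * indicator {v. \<bar>v\<bar> > R} v)"
      using int[of "indicator {v. \<bar>v\<bar> > R}"] by (simp add: indicator_def mult.commute)
    have "h T * C - (\<integral>v. h (T - v / r) * fejer v \<partial>lborel) = (\<integral>v. h T * fejer v - h (T - v / r) * fejer v \<partial>lborel)"
      using int1 by (subst Bochner_Integration.integral_diff) (auto simp: C_def)
    also have "\<bar>\<dots>\<bar> \<le> (\<integral>v. \<bar>h T * fejer v - h (T - v / r) * fejer v\<bar> \<partial>lborel)"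
      by (rule integral_abs_bound)
    also have "\<dots> \<le> (\<integral>v. e / 3 * fejer v + 2 * (fejer v * indicator {v. \<bar>v\<bar> > R} v) \<partial>lborel)"
    proof (rule integral_mono)
      show "integrable lborel (\<lambda>v. e / 3 * fejer v + 2 * (fejer v * indicator {v. \<bar>v\<bar> > R} v))"
        using integrable_fejer tail_int by (intro Bochner_Integration.integrable_add integrable_mult_right) auto
      fix v :: real
      have eq: "\<bar>h T * fejer v - h (T - v / r) * fejer v\<bar> = \<bar>h T - h (T - v / r)\<bar> * fejer v"
        using fejer_nonneg[of v] by (simp add: left_diff_distrib[symmetric] abs_mult)
      show "\<bar>h T * fejer v - h (T - v / r) * fejer v\<bar> \<le> e / 3 * fejer v + 2 * (fejer v * indicator {v. \<bar>v\<bar> > R} v)"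
      proof (cases "\<bar>v\<bar> > R")
        case True
        have "\<bar>h T - h (T - v / r)\<bar> \<le> 2" using bound[of T] bound[of "T - v / r"] by linarith
        then have "\<bar>h T - h (T - v / r)\<bar> * fejer v \<le> 2 * fejer v"
          using fejer_nonneg by (rule mult_right_mono)
        moreover have "0 \<le> e / 3 * fejer v" using e fejer_nonneg[of v] by simp
        ultimately show ?thesis unfolding eq using True by simp
      next
        case False
        then have "\<bar>v / r\<bar> \<le> \<eta>" using R \<eta> by (simp add: r_def abs_mult field_simps)
        then have "\<bar>h T - h (T - v / r)\<bar> * fejer v \<le> e / 3 * fejer v"
          using 2 fejer_nonneg by (intro mult_right_mono) auto
        then show ?thesis unfolding eq using False by simp
      qed
    qed (use int1 in auto)
    also have "\<dots> = e / 3 * C + 2 * (\<integral>v. fejer v * indicator {v. \<bar>v\<bar> > R} v \<partial>lborel)"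
      using integrable_fejer tail_int by (subst Bochner_Integration.integral_add) (auto simp: C_def)
    also have "\<dots> < e / 3 * C + 2 * (e * C / 6)" using R by linarith
    finally have 3: "\<bar>h T * C - (\<integral>v. h (T - v / r) * fejer v \<partial>lborel)\<bar> < 2 * (e * C) / 3"
      by (simp add: mult.commute)
    have "\<bar>x\<bar> < E" if "\<bar>x - i\<bar> < 2 * E / 3" "\<bar>i\<bar> < E / 3" for x i E :: real
      using that by linarith
    from this[OF 3 1] have "\<bar>h T * C\<bar> < e * C" .
    then show "dist (h T) 0 < e" using C by (simp add: abs_mult)
  qed
qed

text \<open>The function is dilated instead of the kernel: h(t/r) has the transform r g(r s), again
  continuous up to the imaginary axis. The limit for the one fixed kernel, read along r T, thus
  yields averages of h over windows of width proportional to 1/r.\<close>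

theorem fejer_tauberian:
  fixes h :: "real \<Rightarrow> real" and g :: "complex \<Rightarrow> complex"
  assumes h [measurable]: "h \<in> borel_measurable borel"
    and bound: "\<And>t. \<bar>h t\<bar> \<le> 1" and neg: "\<And>t. t < 0 \<Longrightarrow> h t = 0"
    and lap: "\<And>s. Re s > 0 \<Longrightarrow> has_bochner_integral lborel (\<lambda>t. h t *\<^sub>R exp (- s * of_real t)) (g s)"
    and cont: "continuous_on {s. Re s \<ge> 0} g"
    and slow: "\<And>\<delta>. \<delta> > 0 \<Longrightarrow> \<exists>\<eta>>0. \<forall>\<^sub>F T in at_top. \<forall>w. \<bar>w\<bar> \<le> \<eta> \<longrightarrow> \<bar>h T - h (T - w)\<bar> \<le> \<delta>"
  shows "(h \<longlongrightarrow> 0) at_top"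
proof (rule slowly_oscillating_tendsto_0[OF h bound slow])
  fix r :: real assume r: "r > 0"
  have "((\<lambda>T. \<integral>v. h ((T - v) / r) * fejer v \<partial>lborel) \<longlongrightarrow> 0) at_top"
  proof (rule fejer_convolution_tendsto_0[where g = "\<lambda>s. of_real r * g (of_real r * s)"])
    show "has_bochner_integral lborel (\<lambda>t. h (t / r) *\<^sub>R exp (- s * of_real t)) (of_real r * g (of_real r * s))"
      if "Re s > 0" for s
    proof -
      have "has_bochner_integral lborel (\<lambda>t. h t *\<^sub>R exp (- (of_real r * s) * of_real t)) (g (of_real r * s))"
        using that r by (intro lap) simp
      then show ?thesis using r
        by (subst lborel_has_bochner_integral_real_affine_iff[where c = r and t = 0])
           (simp_all add: scaleR_conv_of_real field_simps)
    qed
    show "continuous_on {s. Re s \<ge> 0} (\<lambda>s. of_real r * g (of_real r * s))"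
      using r by (intro continuous_intros continuous_on_compose2[OF cont]) auto
  qed (use r bound neg in \<open>auto simp: divide_neg_pos\<close>)
  moreover have "filterlim (\<lambda>T. r * T) at_top at_top"
    using r by (intro filterlim_tendsto_pos_mult_at_top[OF tendsto_const] filterlim_ident)
  ultimately have "((\<lambda>T. \<integral>v. h ((r * T - v) / r) * fejer v \<partial>lborel) \<longlongrightarrow> 0) at_top"
    by (rule filterlim_compose)
  moreover have "(r * T - v) / r = T - v / r" for T v using r by (simp add: diff_divide_distrib)
  ultimately show "((\<lambda>T. \<integral>v. h (T - v / r) * fejer v \<partial>lborel) \<longlongrightarrow> 0) at_top" by simp
qed

section \<open>Convergence of the series of mu(n)/n\<close>

lemma has_bochner_integral_exp_tail:
  fixes u L :: real
  assumes "u > 0"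
  shows "has_bochner_integral lborel (\<lambda>t. indicator {L<..} t * exp (- u * t)) (exp (- u * L) / u)"
proof -
  have "has_bochner_integral lborel (\<lambda>t. indicator {0<..} t * exp (- u * t)) (1 / u)"
    using integrable_I0i_exp_mscale[OF assms] LBINT_I0i_exp_mscale[OF assms]
    by (simp add: has_bochner_integral_iff set_integrable_def interval_lebesgue_integral_0_infty
        set_lebesgue_integral_def mult.commute)
  then have "has_bochner_integral lborel (\<lambda>t. indicator {0<..} (- L + 1 * t) * exp (- u * (- L + 1 * t))) (1 / u)"
    by (subst (asm) lborel_has_bochner_integral_real_affine_iff[where c = 1 and t = "- L"]) simp_all
  from has_bochner_integral_mult_right[OF this, of "exp (- u * L)"]
  have "has_bochner_integral lborel (\<lambda>t. exp (- u * L) * (indicator {0<..} (- L + 1 * t) * exp (- u * (- L + 1 * t))))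
      (exp (- u * L) / u)" by simp
  moreover have "exp (- u * L) * (indicator {0<..} (- L + 1 * t) * exp (- u * (- L + 1 * t)))
      = indicator {L<..} t * exp (- u * t)" for t
  proof -
    have "exp (- u * L) * exp (- u * (- L + 1 * t)) = exp (- u * t)"
      by (simp add: exp_add[symmetric] algebra_simps)
    then show ?thesis by (auto simp: indicator_def)
  qed
  ultimately show ?thesis by simp
qed

lemma has_bochner_integral_cexp_tail:
  fixes s :: complex and L :: real
  assumes "Re s > 0"
  shows "has_bochner_integral lborel (\<lambda>t. indicator {L<..} t *\<^sub>R exp (- s * of_real t)) (exp (- s * of_real L) / s)"
proof -
  let ?f = "\<lambda>t. exp (- s * complex_of_real t)"
  have s: "s \<noteq> 0" using assms by auto
  have int: "integrable lborel (\<lambda>t. indicator {L<..} t *\<^sub>R ?f t)"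
  proof (rule Bochner_Integration.integrable_bound)
    show "integrable lborel (\<lambda>t. indicator {L<..} t * exp (- Re s * t))"
      using has_bochner_integral_exp_tail[OF assms] by (auto simp: has_bochner_integral_iff)
  qed (auto simp: norm_mult)
  have "interval_lebesgue_integral lborel (ereal L) \<infinity> ?f = 0 - (- exp (- s * of_real L) / s)"
  proof (rule interval_integral_FTC_integrable)
    show "set_integrable lborel (einterval (ereal L) \<infinity>) ?f"
      using int by (simp add: set_integrable_def)
    show "((\<lambda>t. - exp (- s * complex_of_real t) / s) has_vector_derivative ?f t) (at t)" for t
    proof -
      have "((\<lambda>z. - exp (- s * z) / s) has_field_derivative exp (- s * of_real t)) (at (of_real t))"
        using s by (auto intro!: derivative_eq_intros)
      then show ?thesis by (rule has_vector_derivative_real_field)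
    qed
    show "(((\<lambda>t. - exp (- s * complex_of_real t) / s) \<circ> real_of_ereal) \<longlongrightarrow> - exp (- s * of_real L) / s) (at_right (ereal L))"
    proof -
      have "((\<lambda>t. - exp (- s * complex_of_real t) / s) \<longlongrightarrow> - exp (- s * of_real L) / s) (at_right L)"
        using s by (intro tendsto_intros)
      then show ?thesis by (simp add: ereal_tendsto_simps)
    qed
    show "(((\<lambda>t. - exp (- s * complex_of_real t) / s) \<circ> real_of_ereal) \<longlongrightarrow> 0) (at_left \<infinity>)"
    proof -
      have "((\<lambda>t. exp (- (Re s * t)) / norm s) \<longlongrightarrow> 0) at_top"
        using assms s by real_asymp
      then have "((\<lambda>t. - exp (- s * complex_of_real t) / s) \<longlongrightarrow> 0) at_top"
        by (intro tendsto_norm_zero_cancel[of "\<lambda>t. - exp (- s * complex_of_real t) / s"]) (simp add: norm_divide)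
      then show ?thesis by (simp add: ereal_tendsto_simps)
    qed
  qed auto
  then show ?thesis
    using int by (simp add: has_bochner_integral_iff interval_lebesgue_integral_def set_lebesgue_integral_def)
qed

definition moebius_over :: "nat \<Rightarrow> real" where
  "moebius_over n = moebius_mu n / real n"

lemma moebius_over_0 [simp]: "moebius_over 0 = 0"
  by (simp add: moebius_over_def)

lemma abs_moebius_over_le: "\<bar>moebius_over n\<bar> \<le> 1 / real n"
  using abs_moebius_mu_le[of n] by (simp add: moebius_over_def divide_right_mono)

text \<open>The indicator is that of $n < e^t$, except at $n = 0$, where \<open>ln 0 = 0\<close> but the coefficient vanishes.\<close>

definition mertens_log :: "real \<Rightarrow> real" where
  "mertens_log t = (\<Sum>n. moebius_over n * indicator {ln (real n)<..} t)"

text \<open>For an integer n, n < e^t holds iff n lies below the ceiling of e^t. The strict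
  inequality makes the value at t = ln N the partial sum over \<open>{..<N}\<close>, as in the
  definition of \<open>sums\<close>.\<close>

lemma mertens_log_sums: "(\<lambda>n. moebius_over n * indicator {ln (real n)<..} t) sums (\<Sum>n<nat \<lceil>exp t\<rceil>. moebius_over n)"
proof -
  have "(\<lambda>n. moebius_over n * indicator {ln (real n)<..} t) sums
      (\<Sum>n<nat \<lceil>exp t\<rceil>. moebius_over n * indicator {ln (real n)<..} t)"
  proof (rule sums_finite)
    fix n assume "n \<notin> {..<nat \<lceil>exp t\<rceil>}"
    then have "real (nat \<lceil>exp t\<rceil>) \<le> real n" by simp
      then have "exp t \<le> real n" using real_nat_ceiling_ge[of "exp t"] by linarith
    then have "t \<le> ln (real n)" by (meson exp_gt_zero less_le_trans ln_ge_iff)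
    then show "moebius_over n * indicator {ln (real n)<..} t = 0" by simp
  qed simp
  also have "(\<Sum>n<nat \<lceil>exp t\<rceil>. moebius_over n * indicator {ln (real n)<..} t) = (\<Sum>n<nat \<lceil>exp t\<rceil>. moebius_over n)"
  proof (rule sum.cong)
    fix n assume "n \<in> {..<nat \<lceil>exp t\<rceil>}"
    then have n: "real n < exp t" by (simp add: zless_nat_eq_int_zless less_ceiling_iff)
    show "moebius_over n * indicator {ln (real n)<..} t = moebius_over n"
    proof (cases "n = 0")
      case False
      then have "ln (real n) < t" using n by (metis ln_exp ln_less_cancel_iff of_nat_0_less_iff exp_gt_zero gr0I)
      then show ?thesis by simp
    qed simp
  qed simp
  finally show ?thesis .
qed

lemma mertens_log_eq: "mertens_log t = (\<Sum>n<nat \<lceil>exp t\<rceil>. moebius_over n)"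
  using mertens_log_sums[of t] by (simp add: mertens_log_def sums_iff)

lemma abs_mertens_log_le: "\<bar>mertens_log t\<bar> \<le> 1"
proof -
  have "(\<Sum>n<N. moebius_over n) = (\<Sum>n=1..N - 1. moebius_mu n / real n)" for N
    by (intro sum.mono_neutral_cong_right) (auto simp: moebius_over_def)
  then show ?thesis unfolding mertens_log_eq using abs_sum_moebius_mu_over_le by simp
qed

lemma mertens_log_neg: "t < 0 \<Longrightarrow> mertens_log t = 0"
proof -
  assume "t < 0"
  then have "nat \<lceil>exp t\<rceil> \<le> 1" by (simp add: nat_le_iff ceiling_le_iff)
  then have "nat \<lceil>exp t\<rceil> = 0 \<or> nat \<lceil>exp t\<rceil> = 1" by linarith
  then show ?thesis unfolding mertens_log_eq by auto
qed

lemma borel_measurable_mertens_log [measurable]: "mertens_log \<in> borel_measurable borel"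
  unfolding mertens_log_def by measurable

text \<open>Each jump at ln n contributes mu(n)/n times n^(-s)/s. Termwise integration is absolute
  because the integrated norms are at most n^(-1 - Re s) / Re s. The 1/s cancels the factor s in the
  Moebius series s / zeta_reg(1 + s).\<close>

lemma mertens_log_laplace:
  assumes s: "Re s > 0"
  shows "has_bochner_integral lborel (\<lambda>t. mertens_log t *\<^sub>R exp (- s * of_real t)) (1 / zeta_reg (1 + s))"
proof -
  define F where "F n t = (moebius_over n * indicator {ln (real n)<..} t) *\<^sub>R exp (- s * complex_of_real t)" for n t
  have Fsums: "(\<lambda>n. F n t) sums (mertens_log t *\<^sub>R exp (- s * of_real t))" for t
    unfolding F_def mertens_log_eq using mertens_log_sums by (rule sums_scaleR_left)
  have Fint: "has_bochner_integral lborel (F n) (moebius_over n *\<^sub>R (exp (- s * of_real (ln (real n))) / s))" for n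
    unfolding F_def scaleR_scaleR[symmetric]
    by (intro has_bochner_integral_scaleR_right has_bochner_integral_cexp_tail s)
  have int: "integrable lborel (F n)" for n using Fint[of n] by (simp add: has_bochner_integral_iff)
  have ae: "AE t in lborel. summable (\<lambda>n. norm (F n t))"
  proof (rule AE_I2)
    fix t
    have "summable (\<lambda>n. \<bar>moebius_over n * indicator {ln (real n)<..} t\<bar> * norm (exp (- s * complex_of_real t)))"
    proof (rule summable_mult2, rule summable_finite[of "{..<nat \<lceil>exp t\<rceil>}"])
      fix n assume "n \<notin> {..<nat \<lceil>exp t\<rceil>}"
      then have "real (nat \<lceil>exp t\<rceil>) \<le> real n" by simp
      then have "exp t \<le> real n" using real_nat_ceiling_ge[of "exp t"] by linarith
      then have "t \<le> ln (real n)" by (meson exp_gt_zero less_le_trans ln_ge_iff)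
      then show "\<bar>moebius_over n * indicator {ln (real n)<..} t\<bar> = 0" by simp
    qed simp
    then show "summable (\<lambda>n. norm (F n t))" by (simp add: F_def)
  qed
  have norms: "(\<integral>t. norm (F n t) \<partial>lborel) = \<bar>moebius_over n\<bar> * (exp (- Re s * ln (real n)) / Re s)" for n
  proof -
    have "norm (F n t) = \<bar>moebius_over n\<bar> * (indicator {ln (real n)<..} t * exp (- Re s * t))" for t
      by (simp add: F_def abs_mult)
    then show ?thesis
      using has_bochner_integral_exp_tail[OF s, of "ln (real n)"] by (simp add: has_bochner_integral_iff)
  qed
  have sm: "summable (\<lambda>n. \<integral>t. norm (F n t) \<partial>lborel)"
  proof (rule summable_comparison_test'[where N = 0])
    show "summable (\<lambda>n. (1 / Re s) * real n powr (- 1 - Re s))"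
      using s by (intro summable_mult) (simp add: summable_real_powr_iff)
    fix n :: nat
    show "norm (\<integral>t. norm (F n t) \<partial>lborel) \<le> (1 / Re s) * real n powr (- 1 - Re s)"
    proof (cases "n = 0")
      case False
      have "\<bar>moebius_over n\<bar> * (exp (- Re s * ln (real n)) / Re s) \<le> 1 / real n * (exp (- Re s * ln (real n)) / Re s)"
        using abs_moebius_over_le[of n] s by (intro mult_right_mono) auto
      also have "\<dots> = (1 / Re s) * real n powr (- 1 - Re s)"
      proof -
        have "real n powr (- 1 - Re s) = real n powr - 1 * real n powr - Re s"
          using powr_add[of "real n" "- 1" "- Re s"] by simp
        also have "\<dots> = (1 / real n) * exp (- Re s * ln (real n))"
          using False by (simp add: powr_minus_divide powr_def exp_minus divide_inverse)
        finally show ?thesis by simp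
      qed
      finally show ?thesis unfolding norms using s by simp
    qed (simp add: norms)
  qed
  have "integrable lborel (\<lambda>t. \<Sum>n. F n t)"
    by (rule integrable_suminf[OF int ae sm])
  moreover have "(\<integral>t. (\<Sum>n. F n t) \<partial>lborel) = (\<Sum>n. \<integral>t. F n t \<partial>lborel)"
    by (rule integral_suminf[OF int ae sm])
  moreover have "(\<Sum>n. F n t) = mertens_log t *\<^sub>R exp (- s * of_real t)" for t
    using Fsums[of t] by (simp add: sums_iff)
  ultimately have "has_bochner_integral lborel (\<lambda>t. mertens_log t *\<^sub>R exp (- s * of_real t)) (\<Sum>n. \<integral>t. F n t \<partial>lborel)"
    by (simp add: has_bochner_integral_iff)
  also have "(\<Sum>n. \<integral>t. F n t \<partial>lborel) = 1 / zeta_reg (1 + s)"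
  proof -
    have "(\<integral>t. F n t \<partial>lborel) = (of_real (moebius_mu n) * of_nat n powr - (1 + s)) / s" for n
    proof (cases "n = 0")
      case False
      have "(\<integral>t. F n t \<partial>lborel) = moebius_over n *\<^sub>R (exp (- s * of_real (ln (real n))) / s)"
        using Fint[of n] by (simp add: has_bochner_integral_iff)
      moreover have "of_nat n powr - (1 + s) = exp (- s * of_real (ln (real n))) / of_nat n"
      proof -
        have "of_nat n powr - (1 + s) = of_nat n powr - s * (of_nat n powr - 1 :: complex)"
          using powr_add[of "of_nat n :: complex" "- 1" "- s"] by (simp add: mult.commute)
        moreover have "of_nat n powr - s = exp (- s * of_real (ln (real n)))"
          using False by (simp add: powr_def Ln_of_nat)
        moreover have "of_nat n powr - 1 = 1 / (of_nat n :: complex)"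
          by (simp add: powr_minus_divide)
        ultimately show ?thesis by (simp only: mult_1_right times_divide_eq_right)
      qed
      ultimately show ?thesis by (simp add: moebius_over_def scaleR_conv_of_real)
    qed (simp add: F_def)
    then have "(\<Sum>n. \<integral>t. F n t \<partial>lborel) = (\<Sum>n. (of_real (moebius_mu n) * of_nat n powr - (1 + s)) / s)"
      by simp
    also have "\<dots> = (\<Sum>n. of_real (moebius_mu n) * of_nat n powr - (1 + s)) / s"
    proof (rule suminf_divide)
      interpret zeta_abs_conv "1 + s" by standard (use s in simp)
      show "summable (\<lambda>n. of_real (moebius_mu n) * of_nat n powr - (1 + s))"
        using summable_on_imp_summable[OF Infinite_Sum.abs_summable_summable[OF moebius_f_abs_summable]]
        by (simp add: f_def)
    qed
    also have "\<dots> = 1 / zeta_reg (1 + s)"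
      using s by (subst moebius_series_eq) auto
    finally show ?thesis .
  qed
  finally show ?thesis .
qed

text \<open>Between e^a and e^b there are at most e^b - e^a + 1 integers, each contributing at most
  e^(-a). The rounding error e^(-a) disappears for large a, which leaves slow oscillation.\<close>

lemma mertens_log_increment:
  assumes "a \<le> b"
  shows "\<bar>mertens_log b - mertens_log a\<bar> \<le> exp (b - a) - 1 + exp (- a)"
proof -
  define M N where "M = nat \<lceil>exp a\<rceil>" and "N = nat \<lceil>exp b\<rceil>"
  have MN: "M \<le> N" unfolding M_def N_def using assms by (intro nat_mono ceiling_mono) simp
  have N: "real N \<le> exp b + 1"
    unfolding N_def using ceiling_correct[of "exp b"] by (simp add: of_nat_nat)
  have M: "exp a \<le> real M" unfolding M_def by (rule real_nat_ceiling_ge)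
  have "mertens_log b - mertens_log a = (\<Sum>n=M..<N. moebius_over n)"
    unfolding mertens_log_eq M_def[symmetric] N_def[symmetric]
    using sum_diff_nat_ivl[of 0 M N moebius_over] MN by (simp add: atLeast0LessThan)
  also have "\<bar>\<dots>\<bar> \<le> (\<Sum>n=M..<N. exp (- a))"
  proof (rule order_trans[OF sum_abs], rule sum_mono)
    fix n assume n: "n \<in> {M..<N}"
    then have "exp a \<le> real n" using M by auto
    moreover from this have "real n > 0" using exp_gt_zero[of a] by linarith
    ultimately have "1 / real n \<le> 1 / exp a" by (intro divide_left_mono) auto
    then show "\<bar>moebius_over n\<bar> \<le> exp (- a)"
      using abs_moebius_over_le[of n] by (simp add: exp_minus inverse_eq_divide)
  qed
  also have "\<dots> = (real N - real M) * exp (- a)" using MN by (simp add: of_nat_diff)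
  also have "\<dots> \<le> (exp b + 1 - exp a) * exp (- a)"
    using M N by (intro mult_right_mono) auto
  also have "\<dots> = exp (b - a) - 1 + exp (- a)"
    by (simp add: algebra_simps exp_diff exp_minus divide_inverse)
  finally show ?thesis .
qed

lemma mertens_log_tendsto_0: "(mertens_log \<longlongrightarrow> 0) at_top"
proof (rule fejer_tauberian[where g = "\<lambda>s. 1 / zeta_reg (1 + s)"])
  show "continuous_on {s. Re s \<ge> 0} (\<lambda>s. 1 / zeta_reg (1 + s))"
  proof (intro continuous_intros)
    show "continuous_on {s. 0 \<le> Re s} (\<lambda>s. zeta_reg (1 + s))"
      by (intro continuous_on_compose2[OF holomorphic_on_imp_continuous_on[OF holomorphic_zeta_reg]]
          continuous_intros) auto
  qed (auto intro!: zeta_reg_nonzero)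
  fix \<delta> :: real assume \<delta>: "\<delta> > 0"
  \<comment> \<open>Chosen so that e^\<eta> - 1 = \<delta>/2; the other \<delta>/2 is reserved for
    the rounding error.\<close>
  define \<eta> where "\<eta> = ln (1 + \<delta> / 2)"
  have \<eta>: "\<eta> > 0" "exp \<eta> = 1 + \<delta> / 2" using \<delta> by (auto simp: \<eta>_def)
  have "((\<lambda>T. exp (- (T - \<eta>))) \<longlongrightarrow> 0) at_top" by real_asymp
  then have "\<forall>\<^sub>F T in at_top. exp (- (T - \<eta>)) < \<delta> / 2" by (rule order_tendstoD(2)) (use \<delta> in simp)
  then have "\<forall>\<^sub>F T in at_top. \<forall>w. \<bar>w\<bar> \<le> \<eta> \<longrightarrow> \<bar>mertens_log T - mertens_log (T - w)\<bar> \<le> \<delta>"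
  proof eventually_elim
    fix T assume T: "exp (- (T - \<eta>)) < \<delta> / 2"
    show "\<forall>w. \<bar>w\<bar> \<le> \<eta> \<longrightarrow> \<bar>mertens_log T - mertens_log (T - w)\<bar> \<le> \<delta>"
    proof (intro allI impI)
      fix w :: real assume w: "\<bar>w\<bar> \<le> \<eta>"
      define a b where "a = min T (T - w)" and "b = max T (T - w)"
      have "\<bar>mertens_log T - mertens_log (T - w)\<bar> = \<bar>mertens_log b - mertens_log a\<bar>"
        by (auto simp: a_def b_def min_def max_def)
      also have "\<dots> \<le> exp (b - a) - 1 + exp (- a)"
        by (rule mertens_log_increment) (auto simp: a_def b_def)
      also have "exp (b - a) \<le> exp \<eta>" using w by (auto simp: a_def b_def min_def max_def)
      also have "exp (- a) \<le> exp (- (T - \<eta>))" using w by (auto simp: a_def min_def)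
      finally show "\<bar>mertens_log T - mertens_log (T - w)\<bar> \<le> \<delta>" using T \<eta> by simp
    qed
  qed
  then show "\<exists>\<eta>>0. \<forall>\<^sub>F T in at_top. \<forall>w. \<bar>w\<bar> \<le> \<eta> \<longrightarrow> \<bar>mertens_log T - mertens_log (T - w)\<bar> \<le> \<delta>"
    using \<eta> by blast
qed (use abs_mertens_log_le mertens_log_neg mertens_log_laplace in simp_all)

theorem moebius_over_sums_0: "moebius_over sums 0"
  unfolding sums_def
proof -
  have "filterlim (\<lambda>N. ln (real N)) at_top sequentially"
    by (intro filterlim_compose[OF ln_at_top] filterlim_real_sequentially)
  from filterlim_compose[OF mertens_log_tendsto_0 this]
  have "(\<lambda>N. mertens_log (ln (real N))) \<longlonglongrightarrow> 0" .
  then show "(\<lambda>N. \<Sum>n<N. moebius_over n) \<longlonglongrightarrow> 0"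
  proof (rule Lim_transform_eventually)
    show "\<forall>\<^sub>F N in sequentially. mertens_log (ln (real N)) = (\<Sum>n<N. moebius_over n)"
      using eventually_gt_at_top[of 0] by eventually_elim (simp add: mertens_log_eq)
  qed
qed

section \<open>Summation by parts and the inverse Gaussian integral\<close>

text \<open>Summation by parts moves the differences onto B, whose increments are nonnegative with
  total at most M. In the bound, the increments up to m weigh at most B m and meet |r| <= K, the
  later ones weigh at most M and meet |r| <= \<epsilon>. Since B enters only through B m and M, the
  estimate is uniform over families of such sequences.\<close>

lemma abel_summation:
  fixes c B r :: "nat \<Rightarrow> real"
  assumes c: "\<And>n. c n = r n - r (Suc n)" and r: "r \<longlonglongrightarrow> 0"
    and B: "incseq B" "\<And>n. 0 \<le> B n" "\<And>n. B n \<le> M"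
  shows "summable (\<lambda>n. c n * B n)"
    and "\<And>K \<epsilon> m. (\<And>n. \<bar>r n\<bar> \<le> K) \<Longrightarrow> (\<And>n. n > m \<Longrightarrow> \<bar>r n\<bar> \<le> \<epsilon>) \<Longrightarrow> 
      \<bar>\<Sum>n. c n * B n\<bar> \<le> K * B m + \<epsilon> * M"
proof -
  define D where "D n = B (Suc n) - B n" for n
  have D: "D n \<ge> 0" for n using B(1) by (simp add: D_def incseq_SucD)
  have partial: "(\<Sum>n<N. c n * B n) = r 0 * B 0 + (\<Sum>n<N. r (Suc n) * D n) - r N * B N" for N
    by (induction N) (simp_all add: c D_def algebra_simps)
  obtain L where L: "B \<longlonglongrightarrow> L" using incseq_convergent[OF B(1)] B(3) by blast
  have "D sums (L - B 0)" unfolding D_def using L by (rule telescope_sums)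
  then have D_sm: "summable D" by (rule sums_summable)
  obtain K0 where K0: "\<And>n. \<bar>r n\<bar> \<le> K0"
    using convergent_imp_Bseq[OF convergentI[OF r]] by (auto simp: Bseq_def)
  have sm: "summable (\<lambda>n. r (Suc n) * D n)"
  proof (rule summable_comparison_test'[where N = 0])
    show "summable (\<lambda>n. K0 * D n)" using D_sm by (rule summable_mult)
    show "norm (r (Suc n) * D n) \<le> K0 * D n" for n
      using K0[of "Suc n"] D[of n] by (simp add: abs_mult mult_right_mono)
  qed
  have "(\<lambda>N. r 0 * B 0 + (\<Sum>n<N. r (Suc n) * D n) - r N * B N) \<longlonglongrightarrow>
      r 0 * B 0 + (\<Sum>n. r (Suc n) * D n) - 0 * L"
    by (intro tendsto_intros summable_LIMSEQ sm r L)
  then have "(\<lambda>n. c n * B n) sums (r 0 * B 0 + (\<Sum>n. r (Suc n) * D n))"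
    by (simp add: sums_def partial)
  then show "summable (\<lambda>n. c n * B n)" by (rule sums_summable)
  fix K \<epsilon> :: real and m
  assume K: "\<And>n. \<bar>r n\<bar> \<le> K" and \<epsilon>: "\<And>n. n > m \<Longrightarrow> \<bar>r n\<bar> \<le> \<epsilon>"
  have "K \<ge> 0" using K[of 0] by linarith
  have "\<epsilon> \<ge> 0" using \<epsilon>[of "Suc m"] by force
  have bound: "\<bar>\<Sum>n<N. c n * B n\<bar> \<le> K * B m + \<epsilon> * (B N - B m) + \<bar>r N\<bar> * M" if "m \<le> N" for N
  proof -
    have tele: "(\<Sum>n=i..<j. D n) = B j - B i" if "i \<le> j" for i j
      using sum_Suc_diff'[OF that, of B] by (simp add: D_def)
    have "\<bar>\<Sum>n<m. r (Suc n) * D n\<bar> \<le> (\<Sum>n<m. K * D n)"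
      using K D by (intro order_trans[OF sum_abs] sum_mono) (simp add: abs_mult mult_right_mono)
    also have "\<dots> = K * (B m - B 0)"
      using tele[of 0 m] by (simp add: sum_distrib_left[symmetric] atLeast0LessThan)
    finally have 1: "\<bar>\<Sum>n<m. r (Suc n) * D n\<bar> \<le> K * B m - K * B 0" by (simp add: right_diff_distrib)
    have "\<bar>\<Sum>n=m..<N. r (Suc n) * D n\<bar> \<le> (\<Sum>n=m..<N. \<epsilon> * D n)"
      using \<epsilon> D by (intro order_trans[OF sum_abs] sum_mono) (simp add: abs_mult mult_right_mono)
    also have "\<dots> = \<epsilon> * (B N - B m)" using tele[OF that] by (simp add: sum_distrib_left[symmetric])
    finally have 2: "\<bar>\<Sum>n=m..<N. r (Suc n) * D n\<bar> \<le> \<epsilon> * (B N - B m)" .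
    have 3: "\<bar>r 0 * B 0\<bar> \<le> K * B 0" using K[of 0] B(2)[of 0] by (simp add: abs_mult mult_right_mono)
    have 4: "\<bar>r N * B N\<bar> \<le> \<bar>r N\<bar> * M" using B(2,3)[of N] by (simp add: abs_mult mult_left_mono)
    have "(\<Sum>n<N. r (Suc n) * D n) = (\<Sum>n<m. r (Suc n) * D n) + (\<Sum>n=m..<N. r (Suc n) * D n)"
      using sum.atLeastLessThan_concat[of 0 m N "\<lambda>n. r (Suc n) * D n"] that by (simp add: atLeast0LessThan)
    then show ?thesis unfolding partial using 1 2 3 4 by linarith
  qed
  have "(\<lambda>N. \<bar>\<Sum>n<N. c n * B n\<bar>) \<longlonglongrightarrow> \<bar>\<Sum>n. c n * B n\<bar>"
    using \<open>summable (\<lambda>n. c n * B n)\<close> by (intro tendsto_intros summable_LIMSEQ)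
  moreover have "(\<lambda>N. K * B m + \<epsilon> * (M - 0) + \<bar>r N\<bar> * M) \<longlonglongrightarrow> K * B m + \<epsilon> * (M - 0) + \<bar>0\<bar> * M"
    using r by (intro tendsto_intros)
  moreover have "\<exists>N. \<forall>n\<ge>N. \<bar>\<Sum>i<n. c i * B i\<bar> \<le> K * B m + \<epsilon> * (M - 0) + \<bar>r n\<bar> * M"
  proof (intro exI[of _ m] allI impI)
    fix n assume "n \<ge> m"
    moreover have "\<epsilon> * (B n - B m) \<le> \<epsilon> * (M - 0)"
      using \<open>\<epsilon> \<ge> 0\<close> B(2)[of m] B(3)[of n] by (intro mult_left_mono) auto
    ultimately show "\<bar>\<Sum>i<n. c i * B i\<bar> \<le> K * B m + \<epsilon> * (M - 0) + \<bar>r n\<bar> * M"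
      using bound[of n] by linarith
  qed
  ultimately have "\<bar>\<Sum>n. c n * B n\<bar> \<le> K * B m + \<epsilon> * (M - 0) + \<bar>0\<bar> * M"
    by (rule LIMSEQ_le)
  then show "\<bar>\<Sum>n. c n * B n\<bar> \<le> K * B m + \<epsilon> * M" by simp
qed

lemma summable_tail_differences:
  fixes c :: "nat \<Rightarrow> real"
  assumes "summable c"
  obtains r where "\<And>n. c n = r n - r (Suc n)" "r \<longlonglongrightarrow> 0"
proof
  show "c n = (suminf c - sum c {..<n}) - (suminf c - sum c {..<Suc n})" for n by simp
  have "(\<lambda>n. suminf c - sum c {..<n}) \<longlonglongrightarrow> suminf c - suminf c"
    by (intro tendsto_intros summable_LIMSEQ assms)
  then show "(\<lambda>n. suminf c - sum c {..<n}) \<longlonglongrightarrow> 0" by simp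
qed

lemma summable_mult_incseq:
  fixes c B :: "nat \<Rightarrow> real"
  assumes "summable c" "incseq B" "\<And>n. 0 \<le> B n" "\<And>n. B n \<le> M"
  shows "summable (\<lambda>n. c n * B n)"
  by (rule summable_tail_differences[OF assms(1)]) (rule abel_summation(1)[OF _ _ assms(2-4)])

text \<open>The cut m depends on the tails of c alone and is therefore chosen before Y. Pointwise
  convergence is then required only at the single index m, as monotonicity controls all smaller
  ones.\<close>

lemma suminf_mult_incseq_tendsto_0:
  fixes c :: "nat \<Rightarrow> real" and B :: "real \<Rightarrow> nat \<Rightarrow> real"
  assumes c: "summable c" and B: "\<And>Y. incseq (B Y)" "\<And>Y n. 0 \<le> B Y n" "\<And>Y n. B Y n \<le> M"
    and lim: "\<And>n. ((\<lambda>Y. B Y n) \<longlongrightarrow> 0) at_top"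
  shows "((\<lambda>Y. \<Sum>n. c n * B Y n) \<longlongrightarrow> 0) at_top"
proof (rule tendstoI)
  fix e :: real assume e: "e > 0"
  obtain r where r: "\<And>n. c n = r n - r (Suc n)" "r \<longlonglongrightarrow> 0"
    using summable_tail_differences[OF c] by blast
  obtain K where K: "K > 0" "\<And>n. \<bar>r n\<bar> \<le> K"
    using convergent_imp_Bseq[OF convergentI[OF r(2)]] by (auto simp: Bseq_def)
  have M: "M \<ge> 0" using B(2,3)[of 0 0] by linarith
  \<comment> \<open>M may be 0; adding 1 keeps the quotient meaningful and makes \<epsilon> M < e/2
    strict.\<close>
  define \<epsilon> where "\<epsilon> = e / (2 * (M + 1))"
  have \<epsilon>: "\<epsilon> > 0" "\<epsilon> * M < e / 2" using M e by (auto simp: \<epsilon>_def field_simps)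
  obtain m where m: "\<And>n. n > m \<Longrightarrow> \<bar>r n\<bar> \<le> \<epsilon>"
    using LIMSEQ_D[OF r(2) \<epsilon>(1)] by (auto intro: less_imp_le)
  have "\<forall>\<^sub>F Y in at_top. B Y m < e / (2 * K)"
    by (rule order_tendstoD(2)[OF lim]) (use e K in simp)
  then show "\<forall>\<^sub>F Y in at_top. dist (\<Sum>n. c n * B Y n) 0 < e"
  proof eventually_elim
    fix Y assume Y: "B Y m < e / (2 * K)"
    have "\<bar>\<Sum>n. c n * B Y n\<bar> \<le> K * B Y m + \<epsilon> * M"
      using abel_summation(2)[OF r B(1) B(2) B(3) K(2) m] .
    moreover have "K * B Y m < e / 2" using Y K(1) by (simp add: field_simps)
    ultimately show "dist (\<Sum>n. c n * B Y n) 0 < e" using \<epsilon>(2) by simp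
  qed
qed

text \<open>\<open>E\<close> is sqrt pi / 2 times the error function. A generic antiderivative is
  normalised at 0; the half-line Gaussian moment gives the limit at infinity and oddness the other
  one.\<close>

lemma gaussian_antiderivative:
  obtains E :: "real \<Rightarrow> real"
  where "\<And>w. (E has_real_derivative exp (- w\<^sup>2)) (at w)"
    "(E \<longlongrightarrow> sqrt pi / 2) at_top" "(E \<longlongrightarrow> - (sqrt pi / 2)) at_bot"
proof -
  have "\<exists>E. \<forall>w::real. - \<infinity> < ereal w \<longrightarrow> ereal w < \<infinity> \<longrightarrow> (E has_vector_derivative exp (- w\<^sup>2)) (at w)"
    by (rule einterval_antiderivative) (auto intro!: continuous_intros)
  then obtain E0 where E0: "\<And>w::real. (E0 has_real_derivative exp (- w\<^sup>2)) (at w)"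
    by (auto simp: has_real_derivative_iff_has_vector_derivative)
  define E where "E w = E0 w - E0 0" for w
  have E: "(E has_real_derivative exp (- w\<^sup>2)) (at w)" for w
    unfolding E_def using E0[of w] by (auto intro!: derivative_eq_intros)
  have odd: "E (- w) = - E w" for w
  proof -
    have "((\<lambda>w. E w + E (- w)) has_real_derivative 0) (at w)" for w
    proof -
      have "((\<lambda>w. E w + E (- w)) has_real_derivative (exp (- w\<^sup>2) + exp (- (- w)\<^sup>2) * (- 1))) (at w)"
        by (intro DERIV_add E DERIV_chain2[OF E] derivative_eq_intros) auto
      then show ?thesis by simp
    qed
    then have "E w + E (- w) = E 0 + E (- 0)" by (intro DERIV_isconst_all) auto
    then show ?thesis by (simp add: E_def)
  qed
  have top: "(E \<longlongrightarrow> sqrt pi / 2) at_top"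
  proof -
    let ?f = "\<lambda>t::real. indicator {0..} t *\<^sub>R exp (- t\<^sup>2)"
    have lim: "((\<lambda>w. \<integral>t. indicator {..w} t *\<^sub>R ?f t \<partial>lborel) \<longlongrightarrow> (\<integral>t. ?f t \<partial>lborel)) at_top"
      using gaussian_moment_0 by (intro tendsto_integral_at_top) (auto simp: has_bochner_integral_iff)
    have val: "(\<integral>t. ?f t \<partial>lborel) = sqrt pi / 2"
      using gaussian_moment_0 by (simp add: has_bochner_integral_iff)
    have ev: "\<forall>\<^sub>F w in at_top. (\<integral>t. indicator {..w} t *\<^sub>R ?f t \<partial>lborel) = E w"
      using eventually_ge_at_top[of 0]
    proof eventually_elim
      fix w :: real assume "0 \<le> w"
      have "(\<integral>t. indicator {..w} t *\<^sub>R ?f t \<partial>lborel) = (\<integral>t. indicator {0..w} t *\<^sub>R exp (- t\<^sup>2) \<partial>lborel)"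
        by (intro Bochner_Integration.integral_cong) (auto simp: indicator_def)
      also have "\<dots> = E w - E 0"
      proof (rule integral_FTC_atLeastAtMost[OF \<open>0 \<le> w\<close>])
        show "(E has_vector_derivative exp (- t\<^sup>2)) (at t within {0..w})" for t
          using E[of t] has_vector_derivative_at_within
          unfolding has_real_derivative_iff_has_vector_derivative by blast
      qed (intro continuous_intros)
      finally show "(\<integral>t. indicator {..w} t *\<^sub>R ?f t \<partial>lborel) = E w" by (simp add: E_def)
    qed
    show ?thesis using Lim_transform_eventually[OF lim ev] unfolding val .
  qed
  have "((\<lambda>w. - E (- w)) \<longlongrightarrow> - (sqrt pi / 2)) at_bot"
    by (intro tendsto_minus filterlim_compose[OF top] filterlim_uminus_at_top_at_bot)
  then have "(E \<longlongrightarrow> - (sqrt pi / 2)) at_bot" by (simp add: odd)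
  with E top show ?thesis using that by blast
qed

lemma has_bochner_integral_inverse_gaussian:
  fixes p q :: real
  assumes p: "p > 0" and q: "q > 0"
  shows "has_bochner_integral lborel
    (\<lambda>y. indicator {0<..} y * (y powr (- 1 / 2) * exp (- (p\<^sup>2 * y) - q\<^sup>2 / y))) (sqrt pi / p * exp (- 2 * p * q))"
proof -
  obtain E :: "real \<Rightarrow> real" where E: "\<And>w. (E has_real_derivative exp (- w\<^sup>2)) (at w)"
    and Etop: "(E \<longlongrightarrow> sqrt pi / 2) at_top" and Ebot: "(E \<longlongrightarrow> - (sqrt pi / 2)) at_bot"
    using gaussian_antiderivative by blast
  let ?f = "\<lambda>y. y powr (- 1 / 2) * exp (- (p\<^sup>2 * y) - q\<^sup>2 / y)"
  \<comment> \<open>Completing the square gives p^2 y + q^2/y = (p sqrt y + q / sqrt y)^2 - 2 p q =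
    (p sqrt y - q / sqrt y)^2 + 2 p q, so both summands differentiate to the same exponential. The
    inner derivatives carry q with opposite signs; these parts cancel in the sum, leaving
    y^(-1/2).\<close>
  define H where "H y = (exp (2 * p * q) * E (p * sqrt y + q / sqrt y)
      + exp (- 2 * p * q) * E (p * sqrt y - q / sqrt y)) / p" for y
  have deriv: "(H has_real_derivative ?f y) (at y)" if y: "y > 0" for y
  proof -
    define s where "s = sqrt y"
    have s: "s > 0" "s\<^sup>2 = y" using y by (auto simp: s_def)
    define X where "X = exp (- (p\<^sup>2 * y) - q\<^sup>2 / y)"
    have 1: "exp (2 * p * q) * exp (- (p * s + q / s)\<^sup>2) = X"
    proof -
      have "(p * s + q / s)\<^sup>2 = p\<^sup>2 * y + q\<^sup>2 / y + 2 * p * q"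
        using s(1) by (simp add: power2_sum power_mult_distrib power_divide flip: s(2))
      then show ?thesis by (simp add: X_def flip: exp_add)
    qed
    have 2: "exp (- 2 * p * q) * exp (- (p * s - q / s)\<^sup>2) = X"
    proof -
      have "(p * s - q / s)\<^sup>2 = p\<^sup>2 * y + q\<^sup>2 / y - 2 * p * q"
        using s(1) by (simp add: power2_diff power_mult_distrib power_divide flip: s(2))
      then show ?thesis by (simp add: X_def flip: exp_add)
    qed
    define d where "d = inverse s / 2"
    have sq: "(sqrt has_real_derivative d) (at y)"
      unfolding d_def s_def by (rule DERIV_real_sqrt[OF y])
    have "(H has_real_derivative
       (exp (2 * p * q) * (exp (- (p * s + q / s)\<^sup>2) * (p * d - q * d / s\<^sup>2))
        + exp (- 2 * p * q) * (exp (- (p * s - q / s)\<^sup>2) * (p * d + q * d / s\<^sup>2))) / p) (at y)"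
    proof -
      have "((\<lambda>y. p * sqrt y + q / sqrt y) has_real_derivative (p * d - q * d / s\<^sup>2)) (at y)"
        using DERIV_add[OF DERIV_cmult[OF sq, of p] DERIV_divide[OF DERIV_const[of q] sq]] s
        by (simp add: s_def power2_eq_square)
      moreover have "((\<lambda>y. p * sqrt y - q / sqrt y) has_real_derivative (p * d + q * d / s\<^sup>2)) (at y)"
        using DERIV_diff[OF DERIV_cmult[OF sq, of p] DERIV_divide[OF DERIV_const[of q] sq]] s
        by (simp add: s_def power2_eq_square)
      ultimately show ?thesis
        unfolding H_def s_def by (intro DERIV_cdivide DERIV_add DERIV_cmult DERIV_chain2[OF E])
    qed
    also have "(exp (2 * p * q) * (exp (- (p * s + q / s)\<^sup>2) * (p * d - q * d / s\<^sup>2))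
        + exp (- 2 * p * q) * (exp (- (p * s - q / s)\<^sup>2) * (p * d + q * d / s\<^sup>2))) / p
        = (X * (p * d - q * d / s\<^sup>2) + X * (p * d + q * d / s\<^sup>2)) / p"
      by (simp only: 1 2 mult.assoc[symmetric])
    also have "\<dots> = X * inverse s" using p by (simp add: d_def field_simps)
    also have "inverse s = y powr (- 1 / 2)"
      using y by (simp add: s_def powr_minus powr_half_sqrt)
    finally show ?thesis by (simp add: X_def mult.commute)
  qed
  have cont: "isCont ?f y" if "y > 0" for y
    using that by (intro continuous_intros) auto
  \<comment> \<open>The argument with the plus sign tends to infinity at both ends, so its
    contribution cancels in \<open>?U - ?L\<close>. The other one runs from minus infinity to
    infinity and contributes the full mass sqrt pi.\<close>
  let ?L = "(exp (2 * p * q) * (sqrt pi / 2) + exp (- 2 * p * q) * (- (sqrt pi / 2))) / p"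
  let ?U = "(exp (2 * p * q) * (sqrt pi / 2) + exp (- 2 * p * q) * (sqrt pi / 2)) / p"
  have l1: "filterlim (\<lambda>y. p * sqrt y + q / sqrt y) at_top (at_right 0)"
    and l2: "filterlim (\<lambda>y. p * sqrt y - q / sqrt y) at_bot (at_right 0)"
    and l3: "filterlim (\<lambda>y. p * sqrt y + q / sqrt y) at_top at_top"
    and l4: "filterlim (\<lambda>y. p * sqrt y - q / sqrt y) at_top at_top"
    using p q by real_asymp+
  have A: "((H \<circ> real_of_ereal) \<longlongrightarrow> ?L) (at_right 0)"
  proof -
    have "(H \<longlongrightarrow> ?L) (at_right 0)"
      unfolding H_def using p
      by (intro tendsto_intros filterlim_compose[OF Etop l1] filterlim_compose[OF Ebot l2]) auto
    then show ?thesis by (simp add: zero_ereal_def ereal_tendsto_simps)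
  qed
  have B: "((H \<circ> real_of_ereal) \<longlongrightarrow> ?U) (at_left \<infinity>)"
  proof -
    have "(H \<longlongrightarrow> ?U) at_top"
      unfolding H_def using p
      by (intro tendsto_intros filterlim_compose[OF Etop l3] filterlim_compose[OF Etop l4]) auto
    then show ?thesis by (simp add: ereal_tendsto_simps)
  qed
  have "set_integrable lborel (einterval 0 \<infinity>) ?f" "interval_lebesgue_integral lborel 0 \<infinity> ?f = ?U - ?L"
    by (rule interval_integral_FTC_nonneg[OF _ deriv cont _ A B]; simp add: zero_ereal_def)+
  moreover have "?U - ?L = sqrt pi / p * exp (- 2 * p * q)"
    using p by (simp add: field_simps)
  moreover have "einterval 0 \<infinity> = {0::real<..}" by (auto simp: einterval_def)
  ultimately show ?thesis
    unfolding has_bochner_integral_iff set_integrable_def interval_lebesgue_integral_0_infty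
      set_lebesgue_integral_def by (simp only: real_scaleR_def)
qed

text \<open>An instance of Hake's theorem: a gauge integral over the half-line exists as soon as the
  truncated integrals converge, even conditionally. An interval [a, b] containing a large ball about
  0 has a <= 0, so it sees exactly (0, b].\<close>

lemma improper_has_integral:
  fixes f :: "real \<Rightarrow> real"
  assumes int: "\<And>b. set_integrable lborel {0<..b} f"
    and lim: "((\<lambda>b. set_lebesgue_integral lborel {0<..b} f) \<longlongrightarrow> I) at_top"
  shows "(f has_integral I) {0<..}"
proof -
  let ?g = "\<lambda>y. if y \<in> {0<..} then f y else 0"
  have hk: "(?g has_integral set_lebesgue_integral lborel {0<..\<beta>} f) {\<alpha>..\<beta>}" if "\<alpha> \<le> 0" for \<alpha> \<beta>
  proof -
    have "((\<lambda>y. indicator {0<..\<beta>} y *\<^sub>R f y) has_integral set_lebesgue_integral lborel {0<..\<beta>} f) UNIV"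
      using has_integral_integral_lborel[OF int[of \<beta>, unfolded set_integrable_def]]
      by (simp add: set_lebesgue_integral_def)
    also have "(\<lambda>y. indicator {0<..\<beta>} y *\<^sub>R f y) = (\<lambda>y. if y \<in> {\<alpha>..\<beta>} then ?g y else 0)"
      using that by (auto simp: indicator_def fun_eq_iff)
    finally show ?thesis by (simp only: has_integral_restrict_UNIV)
  qed
  show ?thesis
  proof (subst has_integral_alt', intro conjI allI impI)
    fix a b :: real
    have "?g integrable_on {min a 0..b}" using hk[of "min a 0" b] by auto
    then show "?g integrable_on cbox a b"
      unfolding box_real by (rule integrable_on_subinterval) auto
  next
    fix e :: real assume e: "e > 0"
    obtain B0 where B0: "\<And>b. b \<ge> B0 \<Longrightarrow> \<bar>set_lebesgue_integral lborel {0<..b} f - I\<bar> < e"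
      using tendstoD[OF lim e] by (auto simp: eventually_at_top_linorder dist_real_def)
    define B where "B = max B0 1"
    show "\<exists>B>0. \<forall>a b. ball 0 B \<subseteq> cbox a b \<longrightarrow> norm (integral (cbox a b) ?g - I) < e"
    proof (intro exI[of _ B] conjI allI impI)
      show "B > 0" by (simp add: B_def)
      fix a b :: real assume sub: "ball 0 B \<subseteq> cbox a b"
      have "0 \<in> cbox a b" using sub \<open>B > 0\<close> by (intro subsetD[OF sub]) auto
      then have "a \<le> 0" by simp
      have "B \<le> b"
      proof (rule dense_le_bounded[OF \<open>B > 0\<close>])
        fix w assume "0 < w" "w < B"
        then have "w \<in> ball 0 B" by simp
        then show "w \<le> b" using sub by auto
      qed
      have "integral {a..b} ?g = set_lebesgue_integral lborel {0<..b} f"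
        using hk[OF \<open>a \<le> 0\<close>] by (rule integral_unique)
      then show "norm (integral (cbox a b) ?g - I) < e"
        using B0[of b] \<open>B \<le> b\<close> by (simp add: B_def)
    qed
  qed
qed

section \<open>Interchange of sum and integral\<close>

locale inverse_gaussian_kernel =
  fixes x a :: real
  assumes x: "x > 0" and a: "a > 0"
begin

definition K :: "real \<Rightarrow> real" where
  "K y = sqrt pi / 2 * y powr (- 1 / 2) * exp (- (x\<^sup>2 / (4 * y)))"

definition k :: "nat \<Rightarrow> real \<Rightarrow> real" where
  "k n y = exp (- (a\<^sup>2 * y / (real (Suc n))\<^sup>2)) * K y"

text \<open>The index n stands for the number n + 1, as in \<open>k\<close>. Dividing by n + 1 is
  what makes the quantity bounded and monotone in n. With \<open>max 0 Y\<close>, negative Y give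
  the full half-line, so the bounds hold for every real Y.\<close>

definition tail :: "real \<Rightarrow> nat \<Rightarrow> real" where
  "tail Y n = (\<integral>y. indicator {max 0 Y<..} y * k n y \<partial>lborel) / real (Suc n)"

lemma K_nonneg: "0 \<le> K y"
  by (simp add: K_def)

lemma k_nonneg: "0 \<le> k n y"
  by (simp add: k_def K_nonneg)

lemma borel_measurable_k [measurable]: "k n \<in> borel_measurable borel"
  unfolding k_def K_def by measurable

text \<open>The inverse Gaussian integral with p = a / (n + 1) and q = x / 2; the factor n + 1 is
  1/p up to a. This linear growth in n reduces the weights mu(n)/n^2 to mu(n)/n.\<close>

lemma k_integral:
  "has_bochner_integral lborel (\<lambda>y. indicator {0<..} y * k n y)
     (pi / (2 * a) * real (Suc n) * exp (- (a * x / real (Suc n))))"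
proof -
  define p q where "p = a / real (Suc n)" and "q = x / 2"
  have "p > 0" "q > 0" using x a by (auto simp: p_def q_def)
  from has_bochner_integral_mult_right[OF has_bochner_integral_inverse_gaussian[OF this], of "sqrt pi / 2"]
  have "has_bochner_integral lborel (\<lambda>y. sqrt pi / 2 * (indicator {0<..} y *
      (y powr (- 1 / 2) * exp (- (p\<^sup>2 * y) - q\<^sup>2 / y)))) (sqrt pi / 2 * (sqrt pi / p * exp (- 2 * p * q)))"
    by simp
  also have "(\<lambda>y. sqrt pi / 2 * (indicator {0<..} y * (y powr (- 1 / 2) * exp (- (p\<^sup>2 * y) - q\<^sup>2 / y))))
      = (\<lambda>y. indicator {0<..} y * k n y)"
  proof
    fix y :: real
    have "exp (- (p\<^sup>2 * y) - q\<^sup>2 / y) = exp (- (a\<^sup>2 * y / (real (Suc n))\<^sup>2)) * exp (- (x\<^sup>2 / (4 * y)))"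
      by (simp add: p_def q_def power_divide flip: exp_add)
    then show "sqrt pi / 2 * (indicator {0<..} y * (y powr (- 1 / 2) * exp (- (p\<^sup>2 * y) - q\<^sup>2 / y)))
        = indicator {0<..} y * k n y"
      by (simp add: k_def K_def)
  qed
  also have "sqrt pi / 2 * (sqrt pi / p * exp (- 2 * p * q))
      = pi / (2 * a) * real (Suc n) * exp (- (a * x / real (Suc n)))"
  proof -
    have "sqrt pi / 2 * (sqrt pi / p * e) = pi / (2 * a) * real (Suc n) * e" for e
      by (simp add: p_def del: of_nat_Suc)
    moreover have "- 2 * p * q = - (a * x / real (Suc n))" by (simp add: p_def q_def del: of_nat_Suc)
    ultimately show ?thesis by (simp only:)
  qed
  finally show ?thesis .
qed

lemma k_integrable_on:
  assumes [measurable]: "A \<in> sets borel" and "A \<subseteq> {0<..}"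
  shows "integrable lborel (\<lambda>y. indicator A y * k n y)"
proof (rule Bochner_Integration.integrable_bound)
  show "integrable lborel (\<lambda>y. indicator {0<..} y * k n y)"
    using k_integral[of n] by (simp add: has_bochner_integral_iff)
  show "AE y in lborel. norm (indicator A y * k n y) \<le> norm (indicator {0<..} y * k n y)"
    using assms(2) by (auto intro!: AE_I2 simp: indicator_def)
qed simp

lemma tail_0: "tail 0 n = pi / (2 * a) * exp (- (a * x / real (Suc n)))"
  using k_integral[of n] by (simp add: tail_def has_bochner_integral_iff)

lemma tail_nonneg: "0 \<le> tail Y n"
  unfolding tail_def by (intro divide_nonneg_nonneg Bochner_Integration.integral_nonneg) (auto simp: k_nonneg)

lemma tail_le: "tail Y n \<le> pi / (2 * a)"
proof -
  have "tail Y n \<le> tail 0 n"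
    unfolding tail_def
    by (intro divide_right_mono integral_mono k_integrable_on) (auto simp: indicator_def k_nonneg)
  also have "\<dots> \<le> pi / (2 * a) * 1"
    unfolding tail_0 using x a by (intro mult_left_mono) auto
  finally show ?thesis by simp
qed

lemma tail_tendsto_0: "((\<lambda>Y. tail Y n) \<longlongrightarrow> 0) at_top"
proof -
  have "((\<lambda>Y. \<integral>y. indicator {max 0 Y<..} y * k n y \<partial>lborel) \<longlongrightarrow> (\<integral>y. 0 \<partial>(lborel::real measure))) at_top"
  proof (rule integral_dominated_convergence_at_top)
    show "integrable lborel (\<lambda>y. indicator {0<..} y * k n y)" by (rule k_integrable_on) auto
    show "AE y in lborel. ((\<lambda>Y. indicator {max 0 Y<..} y * k n y) \<longlongrightarrow> 0) at_top"
    proof (rule AE_I2, rule tendsto_eventually)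
      fix y :: real
      show "\<forall>\<^sub>F Y in at_top. indicator {max 0 Y<..} y * k n y = 0"
        using eventually_ge_at_top[of y] by eventually_elim auto
    qed
    show "\<forall>\<^sub>F Y in at_top. AE y in lborel. norm (indicator {max 0 Y<..} y * k n y) \<le> indicator {0<..} y * k n y"
      by (auto simp: indicator_def k_nonneg)
  qed auto
  then have "((\<lambda>Y. (\<integral>y. indicator {max 0 Y<..} y * k n y \<partial>lborel) / real (Suc n)) \<longlongrightarrow> 0 / real (Suc n)) at_top"
    by (intro tendsto_divide tendsto_const) auto
  then show ?thesis by (simp add: tail_def)
qed

text \<open>The substitution $y = n^2 u$ makes the dependence of the tail on $n$ visibly monotone: the
  domain of integration and the integrand both increase with $n$.\<close>

lemma incseq_tail: "incseq (tail Y)"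
proof -
  define \<phi> where "\<phi> n u = indicator {max 0 Y<..} ((real (Suc n))\<^sup>2 * u) * 
    (exp (- (a\<^sup>2 * u)) * (sqrt pi / 2 * u powr (- 1 / 2)) * exp (- (x\<^sup>2 / (4 * ((real (Suc n))\<^sup>2 * u)))))" for n u
  have eq: "indicator {max 0 Y<..} ((real (Suc n))\<^sup>2 * u) * k n ((real (Suc n))\<^sup>2 * u) = \<phi> n u / real (Suc n)" for n u
  proof (cases "u > 0")
    case True
    have "((real (Suc n))\<^sup>2 * u) powr (- 1 / 2) = ((real (Suc n))\<^sup>2) powr (- 1 / 2) * u powr (- 1 / 2)"
      by (rule powr_mult)
    also have "((real (Suc n))\<^sup>2) powr (- 1 / 2) = 1 / real (Suc n)"
      by (simp add: powr_minus_divide powr_half_sqrt del: of_nat_Suc)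
    finally have "((real (Suc n))\<^sup>2 * u) powr (- 1 / 2) = u powr (- 1 / 2) / real (Suc n)" by simp
    moreover have "a\<^sup>2 * ((real (Suc n))\<^sup>2 * u) / (real (Suc n))\<^sup>2 = a\<^sup>2 * u" by simp
    ultimately show ?thesis by (simp only: \<phi>_def k_def K_def) simp
  next
    case False
    then have "(real (Suc n))\<^sup>2 * u \<le> 0" by (simp add: mult_nonneg_nonpos)
    then have "(real (Suc n))\<^sup>2 * u \<notin> {max 0 Y<..}" by auto
    then show ?thesis by (simp only: \<phi>_def indicator_simps) simp
  qed
  have int: "integrable lborel (\<phi> n)" for n
  proof -
    have "integrable lborel (\<lambda>u. indicator {max 0 Y<..} (0 + (real (Suc n))\<^sup>2 * u) * k n (0 + (real (Suc n))\<^sup>2 * u))"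
      by (rule lborel_integrable_real_affine[OF k_integrable_on]) auto
    then have "integrable lborel (\<lambda>u. \<phi> n u / real (Suc n))" unfolding add_0 eq .
    from integrable_mult_right[OF this, of "real (Suc n)"] show ?thesis by (simp del: of_nat_Suc)
  qed
  \<comment> \<open>All powers of n + 1 cancel: two from the Jacobian against one from y^(-1/2) and
    one from the definition of \<open>tail\<close>.\<close>
  have tail_eq: "tail Y n = (\<integral>u. \<phi> n u \<partial>lborel)" for n
  proof -
    have "(\<integral>y. indicator {max 0 Y<..} y * k n y \<partial>lborel) = (real (Suc n))\<^sup>2 * (\<integral>u. \<phi> n u / real (Suc n) \<partial>lborel)"
      using lborel_integral_real_affine[of "(real (Suc n))\<^sup>2" "\<lambda>y. indicator {max 0 Y<..} y * k n y" 0]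
      unfolding add_0 eq by simp
    then show ?thesis by (simp add: tail_def power2_eq_square del: of_nat_Suc)
  qed
  show ?thesis
  proof (rule incseq_SucI)
    fix n
    show "tail Y n \<le> tail Y (Suc n)"
      unfolding tail_eq
    proof (rule integral_mono[OF int int])
      fix u :: real
      show "\<phi> n u \<le> \<phi> (Suc n) u"
      proof (cases "u > 0")
        case True
        have le: "(real (Suc n))\<^sup>2 * u \<le> (real (Suc (Suc n)))\<^sup>2 * u"
          using True by (intro mult_right_mono power_mono) auto
        have "indicator {max 0 Y<..} ((real (Suc n))\<^sup>2 * u) \<le> (indicator {max 0 Y<..} ((real (Suc (Suc n)))\<^sup>2 * u) :: real)"
          using le by (auto simp: indicator_def simp del: of_nat_Suc)
        moreover have "exp (- (x\<^sup>2 / (4 * ((real (Suc n))\<^sup>2 * u)))) \<le> exp (- (x\<^sup>2 / (4 * ((real (Suc (Suc n)))\<^sup>2 * u))))"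
        proof -
          have "x\<^sup>2 / (4 * ((real (Suc (Suc n)))\<^sup>2 * u)) \<le> x\<^sup>2 / (4 * ((real (Suc n))\<^sup>2 * u))"
            using le True by (intro divide_left_mono mult_left_mono mult_pos_pos) auto
          then show ?thesis by simp
        qed
        ultimately show ?thesis unfolding \<phi>_def by (intro mult_mono mult_left_mono mult_nonneg_nonneg) auto
      next
        case False
        then have "(real (Suc m))\<^sup>2 * u \<notin> {max 0 Y<..}" for m
          using mult_nonneg_nonpos[of "(real (Suc m))\<^sup>2" u] by auto
        then show ?thesis by (simp only: \<phi>_def indicator_simps) simp
      qed
    qed
  qed
qed

abbreviation c :: "nat \<Rightarrow> real" where "c n \<equiv> moebius_over (Suc n)"

lemma summable_c: "summable c"
  using moebius_over_sums_0 by (subst summable_Suc_iff) (rule sums_summable)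

lemma summable_c_tail: "summable (\<lambda>n. c n * tail Y n)"
  using summable_c incseq_tail tail_nonneg tail_le by (rule summable_mult_incseq)

lemma abs_c_le: "\<bar>c n / real (Suc n)\<bar> \<le> 1 / (real (Suc n))\<^sup>2"
  using abs_moebius_over_le[of "Suc n"]
  by (simp add: abs_mult power2_eq_square divide_simps del: of_nat_Suc)

lemma summable_inverse_squares: "summable (\<lambda>n. 1 / (real (Suc n))\<^sup>2)"
  using inverse_squares_sums by (auto simp: sums_iff)

lemma k_le: "k n y \<le> K y" if "y \<ge> 0"
  unfolding k_def using that K_nonneg[of y] by (simp add: mult_left_le_one_le)

lemma summable_series: "y \<ge> 0 \<Longrightarrow> summable (\<lambda>n. \<bar>c n / real (Suc n) * k n y\<bar>)"
proof (rule summable_comparison_test'[where N = 0])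
  show "summable (\<lambda>n. 1 / (real (Suc n))\<^sup>2 * K y)"
    by (intro summable_mult2 summable_inverse_squares)
  show "norm \<bar>c n / real (Suc n) * k n y\<bar> \<le> 1 / (real (Suc n))\<^sup>2 * K y" if "y \<ge> 0" for n
    using mult_mono[OF abs_c_le k_le[OF that] _ k_nonneg] k_nonneg by (simp add: abs_mult)
qed

definition F :: "real \<Rightarrow> real" where
  "F y = (\<Sum>n. c n / real (Suc n) * k n y)"

text \<open>On a bounded interval the integrals of \<open>k n\<close> are bounded uniformly in n, so
  weights of size 1/n^2 allow termwise integration; each term is then a difference of two
  tails.\<close>

lemma F_integral:
  shows "set_integrable lborel {0<..b} F"
    and "b \<ge> 0 \<Longrightarrow> set_lebesgue_integral lborel {0<..b} F = (\<Sum>n. c n * tail 0 n) - (\<Sum>n. c n * tail b n)"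
proof -
  define f where "f n y = c n / real (Suc n) * (indicator {0<..b} y * k n y)" for n y
  have k_int: "integrable lborel (\<lambda>y. indicator {0<..b} y * k n y)" for n
    by (rule k_integrable_on) auto
  have int: "integrable lborel (f n)" for n
    unfolding f_def by (intro integrable_mult_right k_int)
  have sm: "summable (\<lambda>n. \<bar>f n y\<bar>)" for y
  proof (cases "y \<in> {0<..b}")
    case True
    then show ?thesis using summable_series[of y] by (simp add: f_def)
  next
    case False
    then show ?thesis by (simp add: f_def)
  qed
  \<comment> \<open>For 0 < y <= b one has exp(a^2 (b - y)) >= 1, hence \<open>k n\<close> <=
    \<open>K\<close> <= exp(a^2 b) \<open>k 0\<close>, and \<open>k 0\<close> is already known to be
    integrable.\<close>
  define J where "J = exp (a\<^sup>2 * b) * (\<integral>y. indicator {0<..b} y * k 0 y \<partial>lborel)"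
  have J: "(\<integral>y. indicator {0<..b} y * k n y \<partial>lborel) \<le> J" for n
  proof -
    have "(\<integral>y. indicator {0<..b} y * k n y \<partial>lborel) \<le> (\<integral>y. exp (a\<^sup>2 * b) * (indicator {0<..b} y * k 0 y) \<partial>lborel)"
    proof (rule integral_mono[OF k_int integrable_mult_right[OF k_int]])
      fix y :: real
      show "indicator {0<..b} y * k n y \<le> exp (a\<^sup>2 * b) * (indicator {0<..b} y * k 0 y)"
      proof (cases "y \<in> {0<..b}")
        case True
        have "k n y \<le> 1 * K y" using True k_le by simp
        also have "\<dots> \<le> exp (a\<^sup>2 * b - a\<^sup>2 * y) * K y"
          using True a K_nonneg by (intro mult_right_mono) auto
        also have "\<dots> = exp (a\<^sup>2 * b) * k 0 y" by (simp add: k_def flip: exp_add)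
        finally show ?thesis using True by simp
      qed simp
    qed
    then show ?thesis by (simp add: J_def)
  qed
  have norm_sm: "summable (\<lambda>n. \<integral>y. norm (f n y) \<partial>lborel)"
  proof (rule summable_comparison_test'[where N = 0])
    show "summable (\<lambda>n. 1 / (real (Suc n))\<^sup>2 * J)"
      by (intro summable_mult2 summable_inverse_squares)
    fix n
    have "(\<integral>y. norm (f n y) \<partial>lborel) = \<bar>c n / real (Suc n)\<bar> * (\<integral>y. indicator {0<..b} y * k n y \<partial>lborel)"
      by (simp add: f_def abs_mult k_nonneg del: of_nat_Suc)
    also have "\<dots> \<le> 1 / (real (Suc n))\<^sup>2 * J"
      by (intro mult_mono abs_c_le J Bochner_Integration.integral_nonneg) (auto simp: k_nonneg)
    finally show "norm (\<integral>y. norm (f n y) \<partial>lborel) \<le> 1 / (real (Suc n))\<^sup>2 * J"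
      by (simp add: Bochner_Integration.integral_nonneg)
  qed
  have F_eq: "indicator {0<..b} y *\<^sub>R F y = (\<Sum>n. f n y)" for y
    by (auto simp: F_def f_def indicator_def)
  have ae: "AE y in lborel. summable (\<lambda>n. norm (f n y))" using sm by simp
  show "set_integrable lborel {0<..b} F"
    unfolding set_integrable_def F_eq by (rule integrable_suminf[OF int ae norm_sm])
  assume b: "b \<ge> 0"
  have "(\<integral>y. f n y \<partial>lborel) = c n * tail 0 n - c n * tail b n" for n
  proof -
    have "(\<integral>y. indicator {0<..b} y * k n y \<partial>lborel) =
        (\<integral>y. indicator {max 0 0<..} y * k n y - indicator {max 0 b<..} y * k n y \<partial>lborel)"
      using b by (intro Bochner_Integration.integral_cong) (auto simp: indicator_def)
    also have "\<dots> = real (Suc n) * (tail 0 n - tail b n)"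
      unfolding tail_def
      by (subst Bochner_Integration.integral_diff)
         (auto intro!: k_integrable_on simp: right_diff_distrib simp del: of_nat_Suc)
    finally have "(\<integral>y. f n y \<partial>lborel) = c n / real (Suc n) * (real (Suc n) * (tail 0 n - tail b n))"
      by (simp add: f_def del: of_nat_Suc)
    also have "\<dots> = c n * (tail 0 n - tail b n)" by (simp del: of_nat_Suc)
    finally show ?thesis by (simp add: right_diff_distrib)
  qed
  then have "set_lebesgue_integral lborel {0<..b} F = (\<Sum>n. c n * tail 0 n - c n * tail b n)"
    unfolding set_lebesgue_integral_def F_eq using integral_suminf[OF int ae norm_sm] by simp
  then show "set_lebesgue_integral lborel {0<..b} F = (\<Sum>n. c n * tail 0 n) - (\<Sum>n. c n * tail b n)"
    using suminf_diff[OF summable_c_tail summable_c_tail] by simp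
qed

lemma F_has_integral: "(F has_integral (\<Sum>n. c n * tail 0 n)) {0<..}"
proof (rule improper_has_integral[OF F_integral(1)])
  have lim: "((\<lambda>b. (\<Sum>n. c n * tail 0 n) - (\<Sum>n. c n * tail b n)) \<longlongrightarrow> (\<Sum>n. c n * tail 0 n) - 0) at_top"
    by (intro tendsto_diff tendsto_const
        suminf_mult_incseq_tendsto_0[OF summable_c incseq_tail tail_nonneg tail_le tail_tendsto_0])
  have ev: "\<forall>\<^sub>F b in at_top. (\<Sum>n. c n * tail 0 n) - (\<Sum>n. c n * tail b n) = set_lebesgue_integral lborel {0<..b} F"
    using eventually_ge_at_top[of 0] by eventually_elim (simp add: F_integral(2))
  show "((\<lambda>b. set_lebesgue_integral lborel {0<..b} F) \<longlongrightarrow> (\<Sum>n. c n * tail 0 n)) at_top"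
    using Lim_transform_eventually[OF lim ev] by (simp only: diff_0_right)
qed

lemma c_tail_0: "c n * tail 0 n = pi / (2 * a) * (c n * exp (- (a * x / real (Suc n))))"
  by (simp only: tail_0 mult_ac)

text \<open>The case Y = 0 of the Abel summability of the tails, since \<open>tail 0 n\<close> is a
  constant multiple of the exponential.\<close>

lemma summable_c_exp: "summable (\<lambda>n. c n * exp (- (a * x / real (Suc n))))"
  by (rule summable_mult_D[OF summable_c_tail[of 0, unfolded c_tail_0]]) (use a in simp)

lemma suminf_c_tail_0: "a * (\<Sum>n. c n * tail 0 n) = pi / 2 * (\<Sum>n. c n * exp (- (a * x / real (Suc n))))"
  unfolding c_tail_0 suminf_mult[OF summable_c_exp] using a by simp

end

text \<open>\<open>suminf\<close> and \<open>integral\<close> are total functions, so convergence of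
  both series and existence of the integral are asserted along with the identity. Indices are
  shifted by \<open>Suc\<close> to start the sums at 1.\<close>

theorem theorem2p1:
  fixes x a :: real
  assumes "x > 0" and "a > 0"
  shows "summable (\<lambda>n. moebius_mu (Suc n) / real (Suc n) * exp (- (a * x / real (Suc n))))
    \<and> (\<forall>y>0. summable (\<lambda>n. moebius_mu (Suc n) / (real (Suc n))\<^sup>2 * exp (- (a\<^sup>2 * y / (real (Suc n))\<^sup>2))
             * (sqrt pi / 2 * y powr (- 1 / 2) * exp (- (x\<^sup>2 / (4 * y))))))
    \<and> (\<lambda>y. \<Sum>n. moebius_mu (Suc n) / (real (Suc n))\<^sup>2 * exp (- (a\<^sup>2 * y / (real (Suc n))\<^sup>2))
             * (sqrt pi / 2 * y powr (- 1 / 2) * exp (- (x\<^sup>2 / (4 * y))))) integrable_on {0<..}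
    \<and> pi / 2 * (\<Sum>n. moebius_mu (Suc n) / real (Suc n) * exp (- (a * x / real (Suc n))))
       = a * integral {0<..}
           (\<lambda>y. \<Sum>n. moebius_mu (Suc n) / (real (Suc n))\<^sup>2 * exp (- (a\<^sup>2 * y / (real (Suc n))\<^sup>2))
             * (sqrt pi / 2 * y powr (- 1 / 2) * exp (- (x\<^sup>2 / (4 * y)))))"
proof -
  interpret inverse_gaussian_kernel x a by standard (use assms in auto)
  have term_eq: "moebius_mu (Suc n) / (real (Suc n))\<^sup>2 * exp (- (a\<^sup>2 * y / (real (Suc n))\<^sup>2))
      * (sqrt pi / 2 * y powr (- 1 / 2) * exp (- (x\<^sup>2 / (4 * y)))) = c n / real (Suc n) * k n y" for n y
    by (simp add: k_def K_def moebius_over_def power2_eq_square del: of_nat_Suc)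
  have c_eq: "moebius_mu (Suc n) / real (Suc n) = c n" for n
    by (simp add: moebius_over_def)
  show ?thesis
    unfolding term_eq c_eq F_def[symmetric]
  proof (intro conjI allI impI)
    show "summable (\<lambda>n. c n * exp (- (a * x / real (Suc n))))" by (rule summable_c_exp)
    show "summable (\<lambda>n. c n / real (Suc n) * k n y)" if "y > 0" for y
      by (rule summable_rabs_cancel, rule summable_series) (use that in simp)
    show "F integrable_on {0<..}" using F_has_integral by (rule has_integral_integrable)
    show "pi / 2 * (\<Sum>n. c n * exp (- (a * x / real (Suc n)))) = a * integral {0<..} F"
      unfolding integral_unique[OF F_has_integral] by (rule suminf_c_tail_0[symmetric])
  qed
qed

end
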